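(* Let $1\le k\le n$ be integers, $\alpha\in(0,1)$, and let $\lambda\in(0,1)$ be fixed. Let $p_1,\ldots,p_n$ be $p$-values for null hypotheses $H_1,\ldots,H_n$, and suppose that $p_1,\ldots,p_n$ are independent and that those corresponding to the true null hypotheses are i.i.d. $U(0,1)$. Consider Procedure 2: at the first stage, find $j=\max\{1\le i\le n: p_{i:n}\le\lambda\}$; at the second stage, reject $H_{(1)},\ldots,H_{(\hat l)}$, where $$\hat l=\max\left\{1\le i\le j:\ p_{i:n}\le \lambda\min\left[\tilde G_{k,n}^{-1}\left(\frac{i\alpha(1-\lambda)}{\lambda(n-j+1)}\right),\,1\right]\right\};$$ if the maximum does not exist at either stage, do not reject any hypothesis. Then Procedure 2 controls the $k$-FDR at $\alpha$, i.e. $k\text{-FDR}\le\alpha$.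
   Context: A fixed (deterministic) subset of $H_1,\ldots,H_n$ consists of true null hypotheses and the rest are false; $p$-values take values in $[0,1]$, and those of false null hypotheses have arbitrary distributions. $p_{1:n}\le\cdots\le p_{n:n}$ are the ordered $p$-values and $H_{(i)}$ is the null hypothesis corresponding to $p_{i:n}$. For integers $0\le k\le n$, $$G(k,n,u)=\sum_{j=k}^n\binom nj u^j(1-u)^{n-j},$$ and $\tilde G_{k,n}(t)=t\,G(k-1,n-1,t)$, which is a continuous strictly increasing function of $t\in[0,1]$ with $\tilde G_{k,n}(0)=0$ and $\tilde G_{k,n}(1)=1$; $\tilde G_{k,n}^{-1}$ is its inverse function. When the argument $s$ of $\tilde G_{k,n}^{-1}$ exceeds $1$, the quantity $\min[\tilde G_{k,n}^{-1}(s),1]$ is taken to be $1$. For a multiple testing procedure, let $V_n$ be the number of true null hypotheses rejected (false rejections) and $R_n$ the total number of rejections. Then $$k\text{-FDR}=E\left\{\frac{V_n\,I(V_n\ge k)}{\max(R_n,1)}\right\},$$ where $I(A)$ is the indicator of the event $A$. *)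

theory Defs
  imports "HOL-Probability.Probability"
begin

definition binom_tail :: "nat \<Rightarrow> nat \<Rightarrow> real \<Rightarrow> real" where
  "binom_tail k n u = (\<Sum>j=k..n. real (n choose j) * u ^ j * (1 - u) ^ (n - j))"

definition G_tilde :: "nat \<Rightarrow> nat \<Rightarrow> real \<Rightarrow> real" where
  "G_tilde k n t = t * binom_tail (k - 1) (n - 1) t"

text \<open>
  For \<open>1 \<le> k \<le> n\<close>, \<^const>\<open>G_tilde\<close> is a bijection of \<open>{0..1}\<close> onto itself, so the inverse below is
  meaningful exactly for arguments in \<open>{0..1}\<close>.
\<close>

definition G_tilde_inv :: "nat \<Rightarrow> nat \<Rightarrow> real \<Rightarrow> real" where
  "G_tilde_inv k n = the_inv_into {0..1} (G_tilde k n)"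

text \<open>The quantity \<open>min [G_tilde_inv s, 1]\<close>, with the convention that it is 1 when \<open>s > 1\<close>.\<close>

definition capped_G_tilde_inv :: "nat \<Rightarrow> nat \<Rightarrow> real \<Rightarrow> real" where
  "capped_G_tilde_inv k n s = (if s > 1 then 1 else min (G_tilde_inv k n s) 1)"

text \<open>
  A realisation of the p-values is a function \<open>q\<close>, with hypotheses indexed by \<open>{1..n}\<close>.
  The index of the hypothesis belonging to the \<open>i\<close>-th smallest p-value, \<open>1 \<le> i \<le> n\<close>, is read off
  the stable sort of the indices by \<open>q\<close>, so ties are broken in favour of the smaller index.
\<close>

definition ordered_hyp :: "nat \<Rightarrow> (nat \<Rightarrow> real) \<Rightarrow> nat \<Rightarrow> nat" where
  "ordered_hyp n q i = sort_key q [1..<Suc n] ! (i - 1)"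

definition ordered_pval :: "nat \<Rightarrow> (nat \<Rightarrow> real) \<Rightarrow> nat \<Rightarrow> real" where
  "ordered_pval n q i = q (ordered_hyp n q i)"

definition stage1_set :: "nat \<Rightarrow> real \<Rightarrow> (nat \<Rightarrow> real) \<Rightarrow> nat set" where
  "stage1_set n lam q = {i. 1 \<le> i \<and> i \<le> n \<and> ordered_pval n q i \<le> lam}"

definition stage2_set ::
    "nat \<Rightarrow> nat \<Rightarrow> real \<Rightarrow> real \<Rightarrow> (nat \<Rightarrow> real) \<Rightarrow> nat \<Rightarrow> nat set" where
  "stage2_set k n \<alpha> lam q j =
     {i. 1 \<le> i \<and> i \<le> j \<and>
        ordered_pval n q i \<le> lam * capped_G_tilde_inv k n
          (real i * \<alpha> * (1 - lam) / (lam * (real n - real j + 1)))}"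

definition procedure2 ::
    "nat \<Rightarrow> nat \<Rightarrow> real \<Rightarrow> real \<Rightarrow> (nat \<Rightarrow> real) \<Rightarrow> nat set" where
  "procedure2 k n \<alpha> lam q =
     (if stage1_set n lam q = {} then {}
      else let L = stage2_set k n \<alpha> lam q (Max (stage1_set n lam q))
           in if L = {} then {} else ordered_hyp n q ` {1..Max L})"

text \<open>
  The k-FDR of a procedure which at the outcome \<open>\<omega>\<close> rejects the hypotheses in the finite set
  \<open>Rej \<omega>\<close>, where \<open>T\<close> is the set of true null hypotheses.
\<close>

definition kFDR :: "'a measure \<Rightarrow> nat \<Rightarrow> nat set \<Rightarrow> ('a \<Rightarrow> nat set) \<Rightarrow> real" where
  "kFDR M k T Rej =
     (\<integral>\<omega>. real (card (Rej \<omega> \<inter> T)) * (if card (Rej \<omega> \<inter> T) \<ge> k then 1 else 0)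
          / real (max (card (Rej \<omega>)) 1) \<partial>M)"

end

theory Submission
  imports Defs
begin

text \<open>
  Let \<open>N s\<close> be the number of true null p-values that are at most \<open>s\<close>. Fix the number \<open>j\<close> of all
  p-values and the number \<open>x = N lam\<close> of true null p-values that are at most \<open>lam\<close>, and let
  \<open>c 1 \<le> \<dots> \<le> c j \<le> lam\<close> be the resulting thresholds. If \<open>r\<close> hypotheses are rejected, then
  \<open>V = N (c r)\<close>, and the choice of \<open>c r\<close> gives \<open>1 / r \<le> \<beta> x / e r\<close>, where
  \<open>\<beta> = \<alpha> (1 - lam) / (lam (n - j + 1))\<close> and \<open>e r\<close> is the conditional mean of
  \<open>N (c r) I(N (c r) \<ge> k)\<close> given \<open>N lam = x\<close>.
  The event that at least \<open>r\<close> hypotheses are rejected becomes only more likely when a p-value is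
  lowered, and it depends on the counts at levels \<open>\<ge> c r\<close> only. Since \<open>N s\<close> arises from \<open>N t\<close> by
  binomial thinning for \<open>s \<le> t\<close>, an inequality of Chebyshev type lets the sum over \<open>r\<close> telescope, and
  the conditional k-FDR is at most \<open>\<beta> x\<close>. As \<open>n - j \<ge> m - x\<close> for \<open>m\<close> true null hypotheses, it remains to
  note that \<open>x / (m - x + 1) * (1 - lam) / lam * P (N lam = x) = P (N lam = x - 1)\<close>.

  All facts about the joint law of the counts come from moving a single true null p-value from one
  set to another, so neither conditional distributions nor product measures are needed.
\<close>

section \<open>Binomial tails\<close>

lemma binom_tail_0: "binom_tail 0 n u = 1"
proof -
  have "binom_tail 0 n u = (\<Sum>j\<le>n. real (n choose j) * u ^ j * (1 - u) ^ (n - j))"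
    by (simp add: binom_tail_def atMost_atLeast0)
  also have "\<dots> = (u + (1 - u)) ^ n"
    by (rule binomial_ring[symmetric])
  finally show ?thesis by simp
qed

lemma binom_tail_eq_0: "n < k \<Longrightarrow> binom_tail k n u = 0"
  by (simp add: binom_tail_def)

lemma binom_tail_antimono_Suc:
  assumes "0 \<le> u" "u \<le> 1"
  shows "binom_tail (Suc k) n u \<le> binom_tail k n u"
  unfolding binom_tail_def using assms by (intro sum_mono2) auto

text \<open>Conditioning on the first of \<open>Suc n\<close> trials: after a success only
  \<open>k\<close> more are required. The monotonicity proofs below rest on this recursion.\<close>

lemma binom_tail_Suc_Suc:
  "binom_tail (Suc k) (Suc n) u = u * binom_tail k n u + (1 - u) * binom_tail (Suc k) n u"
proof -
  have "binom_tail (Suc k) (Suc n) u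
      = (\<Sum>j=k..n. real (Suc n choose Suc j) * u ^ Suc j * (1 - u) ^ (n - j))"
    unfolding binom_tail_def by (subst sum.shift_bounds_cl_Suc_ivl) simp
  also have "\<dots> = (\<Sum>j=k..n. u * (real (n choose j) * u ^ j * (1 - u) ^ (n - j)))
      + (\<Sum>j=k..n. real (n choose Suc j) * u ^ Suc j * (1 - u) ^ (n - j))"
    by (simp add: sum.distrib[symmetric] algebra_simps)
  also have "(\<Sum>j=k..n. real (n choose Suc j) * u ^ Suc j * (1 - u) ^ (n - j))
      = (\<Sum>j=Suc k..Suc n. real (n choose j) * u ^ j * (1 - u) ^ (Suc n - j))"
    by (subst sum.shift_bounds_cl_Suc_ivl) simp
  also have "\<dots> = (\<Sum>j=Suc k..n. real (n choose j) * u ^ j * (1 - u) ^ (Suc n - j))"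
    by (rule sum.mono_neutral_right) (auto simp: not_le intro: binomial_eq_0)
  also have "\<dots> = (1 - u) * binom_tail (Suc k) n u"
    unfolding binom_tail_def sum_distrib_left
    by (intro sum.cong) (auto simp: Suc_diff_le)
  finally show ?thesis
    by (simp add: binom_tail_def sum_distrib_left)
qed

lemma binom_tail_mono_Suc:
  assumes "0 \<le> u" "u \<le> 1"
  shows "binom_tail k n u \<le> binom_tail k (Suc n) u"
proof (cases k)
  case (Suc l)
  have "u * binom_tail (Suc l) n u \<le> u * binom_tail l n u"
    using assms by (intro mult_left_mono binom_tail_antimono_Suc) auto
  then show ?thesis
    by (simp add: Suc binom_tail_Suc_Suc algebra_simps)
qed (simp add: binom_tail_0)

lemma binom_tail_mono:
  assumes "m \<le> n" "0 \<le> u" "u \<le> 1"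
  shows "binom_tail k m u \<le> binom_tail k n u"
  using assms(1)
  by (rule lift_Suc_mono_le[of "\<lambda>n. binom_tail k n u", rotated]) (rule binom_tail_mono_Suc[OF assms(2,3)])

text \<open>By the recursion the tail is a convex combination of two tails with one trial fewer, and
  \<open>u\<close> is the weight of the larger one. Raising \<open>u\<close> raises both tails by
  induction and then shifts weight to the larger.\<close>

lemma binom_tail_mono_prob:
  assumes "0 \<le> u" "u \<le> v" "v \<le> 1"
  shows "binom_tail k n u \<le> binom_tail k n v"
proof (induction n arbitrary: k)
  case 0
  then show ?case
    by (cases k) (simp_all add: binom_tail_0 binom_tail_eq_0)
next
  case (Suc n)
  show ?case
  proof (cases k)
    case (Suc l)
    have "u * binom_tail l n u + (1 - u) * binom_tail (Suc l) n u
        \<le> u * binom_tail l n v + (1 - u) * binom_tail (Suc l) n v"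
      using assms Suc.IH by (intro add_mono mult_left_mono) auto
    also have "\<dots> = binom_tail (Suc l) n v + u * (binom_tail l n v - binom_tail (Suc l) n v)"
      by (simp add: algebra_simps)
    also have "\<dots> \<le> binom_tail (Suc l) n v + v * (binom_tail l n v - binom_tail (Suc l) n v)"
      using assms binom_tail_antimono_Suc[of v l n] by (intro add_left_mono mult_right_mono) auto
    finally show ?thesis
      by (simp add: Suc binom_tail_Suc_Suc algebra_simps)
  qed (simp add: binom_tail_0)
qed

lemma binom_tail_pos:
  assumes "k \<le> n" "0 < u" "u \<le> 1"
  shows "0 < binom_tail k n u"
proof -
  have "0 < real (n choose n) * u ^ n * (1 - u) ^ (n - n)"
    using assms by simp
  also have "\<dots> \<le> binom_tail k n u"
    unfolding binom_tail_def using assms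
    by (intro member_le_sum) auto
  finally show ?thesis .
qed

lemma binom_tail_1: "k \<le> n \<Longrightarrow> binom_tail k n 1 = 1"
proof -
  assume "k \<le> n"
  have "binom_tail k n 1 = (\<Sum>j\<in>{n}. real (n choose j) * 1 ^ j * (1 - 1) ^ (n - j))"
    unfolding binom_tail_def using \<open>k \<le> n\<close> by (intro sum.mono_neutral_right) auto
  then show ?thesis by simp
qed

text \<open>Absorption turns \<open>z * (y choose z)\<close> into
  \<open>y * ((y - 1) choose (z - 1))\<close> in this truncated binomial mean. With
  \<open>y = n\<close> the value is \<open>n * G_tilde k n u\<close>, which is how
  \<open>G_tilde\<close> enters the thresholds. The upper limit \<open>m\<close> does not depend on
  \<open>y\<close>, so sums over \<open>y\<close> and \<open>z\<close> can be swapped later.\<close>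

lemma sum_binomial_ge:
  assumes "1 \<le> k" "y \<le> m"
  shows "(\<Sum>z=k..m. real z * (real (y choose z) * u ^ z * (1 - u) ^ (y - z)))
       = real y * u * binom_tail (k - 1) (y - 1) u"
proof -
  obtain l where l: "k = Suc l" using assms by (cases k) auto
  have "(\<Sum>z=k..m. real z * (real (y choose z) * u ^ z * (1 - u) ^ (y - z)))
      = (\<Sum>z=k..y. real z * (real (y choose z) * u ^ z * (1 - u) ^ (y - z)))"
    using assms by (intro sum.mono_neutral_right) (auto simp: not_le)
  also have "\<dots> = real y * u * binom_tail (k - 1) (y - 1) u"
  proof (cases y)
    case (Suc w)
    have "real (Suc z) * real (Suc w choose Suc z) = real (Suc w) * real (w choose z)" for z
      by (metis Suc_times_binomial_eq mult.commute of_nat_mult)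
    then show ?thesis
      unfolding Suc l sum.shift_bounds_cl_Suc_ivl binom_tail_def sum_distrib_left
      by (intro sum.cong refl)
        (simp del: of_nat_Suc binomial_Suc_Suc add: mult.assoc[symmetric], simp add: ac_simps)
  qed (use l in simp)
  finally show ?thesis .
qed

section \<open>Inverting \<open>G_tilde\<close> and capping the inverse\<close>

lemma G_tilde_strict_mono:
  assumes "k \<le> n" "1 \<le> k" "0 \<le> u" "u < v" "v \<le> 1"
  shows "G_tilde k n u < G_tilde k n v"
proof -
  have "u * binom_tail (k - 1) (n - 1) u \<le> u * binom_tail (k - 1) (n - 1) v"
    using assms by (intro mult_left_mono binom_tail_mono_prob) auto
  also have "\<dots> < v * binom_tail (k - 1) (n - 1) v"
    using assms by (intro mult_strict_right_mono binom_tail_pos) auto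
  finally show ?thesis by (simp add: G_tilde_def)
qed

lemma inj_on_G_tilde:
  assumes "1 \<le> k" "k \<le> n"
  shows "inj_on (G_tilde k n) {0..1}"
  using G_tilde_strict_mono[OF assms(2,1)]
  by (intro strict_mono_on_imp_inj_on strict_mono_onI) auto

lemma G_tilde_inv:
  assumes "1 \<le> k" "k \<le> n" "0 \<le> s" "s \<le> 1"
  shows "G_tilde_inv k n s \<in> {0..1}" "G_tilde k n (G_tilde_inv k n s) = s"
proof -
  have "G_tilde k n 0 = 0" "G_tilde k n 1 = 1"
    using assms by (simp_all add: G_tilde_def binom_tail_1)
  moreover have "continuous_on {0..1} (G_tilde k n)"
    unfolding G_tilde_def binom_tail_def by (intro continuous_intros)
  ultimately have "s \<in> G_tilde k n ` {0..1}"
    using IVT'[of "G_tilde k n" 0 s 1] assms by (auto simp: image_iff)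
  then show "G_tilde_inv k n s \<in> {0..1}" "G_tilde k n (G_tilde_inv k n s) = s"
    unfolding G_tilde_inv_def
    using the_inv_into_into[OF inj_on_G_tilde[OF assms(1,2)] _ subset_refl]
      f_the_inv_into_f[OF inj_on_G_tilde[OF assms(1,2)]] by auto
qed

text \<open>For \<open>s > 1\<close> the cap gives the value 1, where \<open>G_tilde\<close> equals
  1, so only an inequality survives. Positivity holds because \<open>G_tilde\<close> vanishes at 0;
  it later allows division by the conditional moments.\<close>

lemma capped_G_tilde_inv_bounds:
  assumes "1 \<le> k" "k \<le> n" "0 < s"
  shows "0 < capped_G_tilde_inv k n s" "capped_G_tilde_inv k n s \<le> 1"
    "G_tilde k n (capped_G_tilde_inv k n s) \<le> s"
proof -
  show "0 < capped_G_tilde_inv k n s"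
  proof (cases "s > 1")
    case False
    then have "G_tilde_inv k n s \<noteq> 0"
      using G_tilde_inv(2)[OF assms(1,2), of s] assms by (auto simp: G_tilde_def)
    then show ?thesis
      using False G_tilde_inv(1)[OF assms(1,2), of s] assms by (auto simp: capped_G_tilde_inv_def)
  qed (simp add: capped_G_tilde_inv_def)
  show "capped_G_tilde_inv k n s \<le> 1" by (simp add: capped_G_tilde_inv_def)
  show "G_tilde k n (capped_G_tilde_inv k n s) \<le> s"
  proof (cases "s > 1")
    case True
    then show ?thesis
      using assms by (simp add: capped_G_tilde_inv_def G_tilde_def binom_tail_1)
  next
    case False
    then show ?thesis
      using G_tilde_inv[OF assms(1,2), of s] assms by (auto simp: capped_G_tilde_inv_def min_def)
  qed
qed

lemma capped_G_tilde_inv_mono: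
  assumes "1 \<le> k" "k \<le> n" "0 \<le> s" "s \<le> t"
  shows "capped_G_tilde_inv k n s \<le> capped_G_tilde_inv k n t"
proof (cases "t > 1")
  case False
  then have "G_tilde_inv k n s \<le> G_tilde_inv k n t"
    using G_tilde_inv[OF assms(1,2), of s] G_tilde_inv[OF assms(1,2), of t]
      G_tilde_strict_mono[OF assms(2,1), of "G_tilde_inv k n t" "G_tilde_inv k n s"] assms
    by (force simp: not_le[symmetric])
  then show ?thesis using False assms by (auto simp: capped_G_tilde_inv_def)
qed (auto simp: capped_G_tilde_inv_def)

section \<open>Sequences with monotone ratio\<close>

text \<open>The recursions say that \<open>a (Suc y) / a y\<close> dominates
  \<open>b (Suc y) / b y\<close>, so \<open>a / b\<close> is nondecreasing. All is cross-multiplied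
  because either sequence may vanish.\<close>

lemma ratio_cross_le:
  fixes a b :: "nat \<Rightarrow> real"
  assumes "0 \<le> c" "0 < d" "\<And>y. 0 \<le> a y" "\<And>y. 0 \<le> b y"
    and a: "\<And>y. y < x \<Longrightarrow> real (x - y) * d * a y \<le> real (Suc y) * c * a (Suc y)"
    and b: "\<And>y. y < x \<Longrightarrow> real (Suc y) * c * b (Suc y) \<le> real (x - y) * d * b y"
    and "y \<le> z" "z \<le> x"
  shows "a y * b z \<le> a z * b y"
proof (cases "c = 0")
  \<comment> \<open>With \<open>c = 0\<close> no ratio is available, but then the recursion for
    \<open>a\<close> forces \<open>a y = 0\<close> whenever \<open>y < x\<close>.\<close>
  case True
  show ?thesis
  proof (cases "y = x")
    case False
    then have le: "(real (x - y) * d) * a y \<le> 0" and pos: "0 < real (x - y) * d"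
      using a[of y] True assms by auto
    have "a y \<le> 0"
      using mult_pos_pos[OF pos, of "a y"] le by linarith
    then have "a y = 0"
      using assms(3)[of y] by simp
    then show ?thesis using assms by simp
  qed (use assms in simp)
next
  case False
  with \<open>0 \<le> c\<close> have c: "0 < c" by simp
  show ?thesis
    using \<open>y \<le> z\<close> \<open>z \<le> x\<close>
  proof (induction z rule: dec_induct)
    case (step z)
    then have IH: "a y * b z \<le> a z * b y" and "z < x" by auto
    have "real (Suc z) * c * (a y * b (Suc z)) = a y * (real (Suc z) * c * b (Suc z))"
      by (simp add: algebra_simps)
    also have "\<dots> \<le> a y * (real (x - z) * d * b z)"
      using b[OF \<open>z < x\<close>] assms by (intro mult_left_mono) auto
    also have "\<dots> = real (x - z) * d * (a y * b z)" by (simp add: algebra_simps)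
    also have "\<dots> \<le> real (x - z) * d * (a z * b y)"
      using IH assms by (intro mult_left_mono) auto
    also have "\<dots> = (real (x - z) * d * a z) * b y" by (simp add: algebra_simps)
    also have "\<dots> \<le> (real (Suc z) * c * a (Suc z)) * b y"
      using a[OF \<open>z < x\<close>] assms by (intro mult_right_mono) auto
    also have "\<dots> = real (Suc z) * c * (a (Suc z) * b y)" by (simp add: algebra_simps)
    finally show ?case
      using c by (subst (asm) mult_le_cancel_left_pos) auto
  qed simp
qed

lemma binomial_weight_recursion:
  fixes u :: real
  assumes "z < y"
  shows "real (Suc z) * (1 - u) * (real (y choose Suc z) * u ^ Suc z * (1 - u) ^ (y - Suc z))
       = real (y - z) * u * (real (y choose z) * u ^ z * (1 - u) ^ (y - z))"
proof -
  have "real (Suc z) * real (y choose Suc z) = real (y - z) * real (y choose z)"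
    by (metis binomial_absorb_comp binomial_absorption mult.commute of_nat_mult)
  moreover have "(1 - u) ^ (y - z) = (1 - u) * (1 - u) ^ (y - Suc z)"
    using assms by (metis Suc_diff_Suc power_Suc)
  moreover have "real (Suc z) * (1 - u) * (real (y choose Suc z) * u ^ Suc z * (1 - u) ^ (y - Suc z))
      = (real (Suc z) * real (y choose Suc z)) * (u * u ^ z) * ((1 - u) * (1 - u) ^ (y - Suc z))"
    by (simp only: power_Suc ac_simps)
  ultimately show ?thesis by (simp only: ac_simps)
qed

text \<open>The recursion fixes all ratios, so \<open>a\<close> is a multiple of the binomial
  weights with parameter \<open>s / t\<close>. These sum to 1, so the multiple is the total mass of
  \<open>a\<close>.\<close>

lemma binomial_weight_unique:
  fixes a :: "nat \<Rightarrow> real"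
  assumes "0 < s" "s \<le> t" "\<And>z. 0 \<le> a z"
    and rec: "\<And>z. z < y \<Longrightarrow> real (Suc z) * (t - s) * a (Suc z) = real (y - z) * s * a z"
    and "z \<le> y"
  shows "a z = real (y choose z) * (s / t) ^ z * (1 - s / t) ^ (y - z) * (\<Sum>w\<le>y. a w)"
proof -
  let ?b = "\<lambda>z. real (y choose z) * (s / t) ^ z * (1 - s / t) ^ (y - z)"
  have t: "0 < t" using assms by simp
  have b0: "0 \<le> ?b z" for z
    using assms by (intro mult_nonneg_nonneg zero_le_power) auto
  have recb: "real (Suc z) * (t - s) * ?b (Suc z) = real (y - z) * s * ?b z" if "z < y" for z
  proof -
    have ts: "t - s = t * (1 - s / t)" and s: "real (y - z) * s = t * (real (y - z) * (s / t))"
      using t by (simp_all add: field_simps)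
    have "real (Suc z) * (t - s) * ?b (Suc z) = t * (real (Suc z) * (1 - s / t) * ?b (Suc z))"
      unfolding ts by (simp only: ac_simps)
    also have "\<dots> = t * (real (y - z) * (s / t) * ?b z)"
      by (simp only: binomial_weight_recursion[OF that])
    also have "\<dots> = real (y - z) * s * ?b z"
      unfolding s by (simp only: ac_simps)
    finally show ?thesis .
  qed
  \<comment> \<open>Both sequences satisfy the recursion with equality, so the comparison of ratios
    applies in both directions; \<open>s = t\<close> is included.\<close>
  have cross: "a z * ?b w = a w * ?b z" if "z \<le> w" "w \<le> y" for z w
    using ratio_cross_le[of "t - s" s a ?b y z w] ratio_cross_le[of "t - s" s ?b a y z w]
      assms b0 rec recb that by (intro antisym) (auto simp: mult.commute)
  have "a z * ?b w = a w * ?b z" if "w \<le> y" for w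
    using cross[of z w] cross[of w z] that \<open>z \<le> y\<close> by (cases "z \<le> w") auto
  then have "a z * (\<Sum>w\<le>y. ?b w) = (\<Sum>w\<le>y. a w) * ?b z"
    unfolding sum_distrib_left sum_distrib_right by (intro sum.cong) auto
  moreover have "(\<Sum>w\<le>y. ?b w) = 1"
    using binom_tail_0[of y "s / t"] by (simp add: binom_tail_def atMost_atLeast0)
  ultimately show ?thesis by (simp add: mult.commute)
qed

text \<open>A weighted Chebyshev inequality: the mean of the nondecreasing \<open>g\<close> under
  the weights \<open>w * a\<close> is at least its mean under \<open>w * b\<close>, up to
  denominators. Symmetrising the double sum in \<open>y\<close> and \<open>z\<close> leaves products
  of two factors of equal sign.\<close>

lemma sum_cross_Chebyshev:
  fixes a b w g :: "nat \<Rightarrow> real"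
  assumes "\<And>y. y \<in> A \<Longrightarrow> 0 \<le> w y"
    and "\<And>y z. y \<in> A \<Longrightarrow> z \<in> A \<Longrightarrow> y \<le> z \<Longrightarrow> a y * b z \<le> a z * b y"
    and "\<And>y z. y \<in> A \<Longrightarrow> z \<in> A \<Longrightarrow> y \<le> z \<Longrightarrow> g y \<le> g z"
  shows "(\<Sum>y\<in>A. w y * a y) * (\<Sum>y\<in>A. w y * g y * b y)
       \<le> (\<Sum>y\<in>A. w y * g y * a y) * (\<Sum>y\<in>A. w y * b y)"
proof -
  let ?D = "\<Sum>y\<in>A. \<Sum>z\<in>A. w y * w z * (a y * b z) * (g y - g z)"
  have "?D = (\<Sum>y\<in>A. \<Sum>z\<in>A. w y * w z * (a z * b y) * (g z - g y))"
    by (subst sum.swap) (simp add: mult.commute mult.left_commute)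
  then have "2 * ?D = (\<Sum>y\<in>A. \<Sum>z\<in>A. w y * w z * ((a y * b z - a z * b y) * (g y - g z)))"
    unfolding mult_2
  proof -
    assume "?D = (\<Sum>y\<in>A. \<Sum>z\<in>A. w y * w z * (a z * b y) * (g z - g y))"
    then have "?D + ?D = ?D + (\<Sum>y\<in>A. \<Sum>z\<in>A. w y * w z * (a z * b y) * (g z - g y))"
      by simp
    also have "\<dots> = (\<Sum>y\<in>A. \<Sum>z\<in>A. w y * w z * ((a y * b z - a z * b y) * (g y - g z)))"
      unfolding sum.distrib[symmetric] by (intro sum.cong refl) (simp add: algebra_simps)
    finally show "?D + ?D = \<dots>" .
  qed
  also have "\<dots> \<ge> 0"
  proof (intro sum_nonneg mult_nonneg_nonneg[OF mult_nonneg_nonneg])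
    fix y z assume yz: "y \<in> A" "z \<in> A"
    show "0 \<le> (a y * b z - a z * b y) * (g y - g z)"
    proof (cases "y \<le> z")
      case True
      then show ?thesis using assms(2,3)[OF yz] by (intro mult_nonpos_nonpos) auto
    next
      case False
      then show ?thesis using assms(2,3)[OF yz(2,1)] by (intro mult_nonneg_nonneg) auto
    qed
  qed (use assms in auto)
  finally have "0 \<le> ?D" by simp
  also have "?D = (\<Sum>y\<in>A. w y * g y * a y) * (\<Sum>y\<in>A. w y * b y)
      - (\<Sum>y\<in>A. w y * a y) * (\<Sum>y\<in>A. w y * g y * b y)"
    unfolding sum_product sum_subtractf[symmetric]
    by (intro sum.cong refl) (simp add: algebra_simps)
  finally show ?thesis by simp
qed

section \<open>Counts of p-values below a level, and order statistics\<close>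

definition count_le :: "nat set \<Rightarrow> (nat \<Rightarrow> real) \<Rightarrow> real \<Rightarrow> nat" where
  "count_le S q \<theta> = card {i \<in> S. q i \<le> \<theta>}"

lemma count_le_mono: "finite S \<Longrightarrow> s \<le> t \<Longrightarrow> count_le S q s \<le> count_le S q t"
  unfolding count_le_def by (intro card_mono) auto

lemma count_le_le_card: "finite S \<Longrightarrow> count_le S q \<theta> \<le> card S"
  unfolding count_le_def by (intro card_mono) auto

lemma count_le_upd_same:
  "(i \<in> S \<Longrightarrow> q i \<le> \<theta> \<longleftrightarrow> v \<le> \<theta>) \<Longrightarrow> count_le S (q(i := v)) \<theta> = count_le S q \<theta>"
  unfolding count_le_def by (intro arg_cong[where f = card]) auto

lemma count_le_upd_mono:
  "finite S \<Longrightarrow> v \<le> \<theta> \<Longrightarrow> count_le S q \<theta> \<le> count_le S (q(i := v)) \<theta>"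
  unfolding count_le_def by (intro card_mono) auto

lemma count_le_upd_Suc:
  assumes "finite S" "i \<in> S" "\<theta> < q i" "v \<le> \<theta>"
  shows "count_le S (q(i := v)) \<theta> = Suc (count_le S q \<theta>)"
proof -
  have "{j \<in> S. (q(i := v)) j \<le> \<theta>} = insert i {j \<in> S. q j \<le> \<theta>}"
    using assms by auto
  then show ?thesis using assms by (simp add: count_le_def)
qed

lemma count_le_upd_pred:
  assumes "finite S" "i \<in> S" "q i \<le> \<theta>" "\<theta> < v"
  shows "Suc (count_le S (q(i := v)) \<theta>) = count_le S q \<theta>"
  using count_le_upd_Suc[OF assms(1,2), of \<theta> "q(i := v)" "q i"] assms by simp

lemma count_le_cong: "(\<And>i. i \<in> S \<Longrightarrow> q i = q' i) \<Longrightarrow> count_le S q \<theta> = count_le S q' \<theta>"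
  unfolding count_le_def by (intro arg_cong[where f = card]) auto

lemma card_between:
  assumes "finite S" "s \<le> t"
  shows "card {i \<in> S. s < q i \<and> q i \<le> t} = count_le S q t - count_le S q s"
proof -
  have "{i \<in> S. s < q i \<and> q i \<le> t} = {i \<in> S. q i \<le> t} - {i \<in> S. q i \<le> s}" by auto
  moreover have "{i \<in> S. q i \<le> s} \<subseteq> {i \<in> S. q i \<le> t}" using assms by auto
  ultimately show ?thesis
    unfolding count_le_def using assms by (simp add: card_Diff_subset)
qed

lemma card_gt:
  assumes "finite S"
  shows "card {i \<in> S. s < q i} = card S - count_le S q s"
proof -
  have "{i \<in> S. s < q i} = S - {i \<in> S. q i \<le> s}" by auto
  then show ?thesis
    unfolding count_le_def using assms by (simp add: card_Diff_subset)
qed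

text \<open>In a sorted list the entries that are at most \<open>\<theta>\<close> form an initial
  segment.\<close>

lemma sorted_nth_le_iff:
  fixes q :: "'b \<Rightarrow> 'c::linorder"
  assumes "sorted (map q xs)" "i < length xs"
  shows "q (xs ! i) \<le> \<theta> \<longleftrightarrow> i < length (filter (\<lambda>x. q x \<le> \<theta>) xs)"
  using assms
proof (induction xs arbitrary: i)
  case (Cons x xs)
  show ?case
  proof (cases "q x \<le> \<theta>")
    case True
    then show ?thesis using Cons by (cases i) auto
  next
    case False
    then have "\<not> q y \<le> \<theta>" if "y \<in> set (x # xs)" for y
      using Cons.prems that by auto
    then show ?thesis using Cons.prems nth_mem[of i "x # xs"] by (auto simp: filter_empty_conv)
  qed
qed simp

text \<open>This removes the sort: conditions on order statistics become conditions on counts, which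
  react simply to a change of one p-value.\<close>

lemma ordered_pval_le_iff:
  assumes "1 \<le> i" "i \<le> n"
  shows "ordered_pval n q i \<le> \<theta> \<longleftrightarrow> i \<le> count_le {1..n} q \<theta>"
proof -
  let ?xs = "sort_key q [1..<Suc n]"
  have "count_le {1..n} q \<theta> = card (set (filter (\<lambda>x. q x \<le> \<theta>) ?xs))"
    unfolding count_le_def by (intro arg_cong[where f = card]) (auto simp del: upt_Suc)
  also have "\<dots> = length (filter (\<lambda>x. q x \<le> \<theta>) ?xs)"
    by (intro distinct_card distinct_filter) (simp del: upt_Suc)
  finally show ?thesis
    using sorted_nth_le_iff[of q ?xs "i - 1" \<theta>] assms
    by (auto simp: ordered_pval_def ordered_hyp_def simp del: upt_Suc)
qed

text \<open>The first \<open>L\<close> ordered hypotheses are distinct and have p-values at most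
  \<open>\<theta>\<close>. As exactly \<open>L\<close> hypotheses qualify, cardinality forces
  equality, and no tie is cut.\<close>

lemma ordered_hyp_image:
  assumes "L \<le> n" "count_le {1..n} q \<theta> = L"
  shows "ordered_hyp n q ` {1..L} = {i \<in> {1..n}. q i \<le> \<theta>}"
proof (rule card_subset_eq)
  let ?xs = "sort_key q [1..<Suc n]"
  have len: "length ?xs = n" by (simp del: upt_Suc)
  have set_xs: "set ?xs = {1..n}" by (auto simp del: upt_Suc)
  have "ordered_hyp n q i \<in> set ?xs" if "i \<in> {1..L}" for i
    unfolding ordered_hyp_def using that assms len by (intro nth_mem) auto
  then have "ordered_hyp n q i \<in> {1..n}" if "i \<in> {1..L}" for i
    using that unfolding set_xs .
  moreover have "q (ordered_hyp n q i) \<le> \<theta>" if "i \<in> {1..L}" for i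
    using ordered_pval_le_iff[of i n q \<theta>] that assms by (auto simp: ordered_pval_def)
  ultimately show "ordered_hyp n q ` {1..L} \<subseteq> {i \<in> {1..n}. q i \<le> \<theta>}" by blast
  have "inj_on (ordered_hyp n q) {1..L}"
  proof (rule inj_onI)
    fix a b assume ab: "a \<in> {1..L}" "b \<in> {1..L}" "ordered_hyp n q a = ordered_hyp n q b"
    have "distinct ?xs" by (simp del: upt_Suc)
    with ab have "a - 1 = b - 1"
      unfolding ordered_hyp_def using nth_eq_iff_index_eq[of ?xs "a - 1" "b - 1"] assms len by auto
    with ab show "a = b" by auto
  qed
  then show "card (ordered_hyp n q ` {1..L}) = card {i \<in> {1..n}. q i \<le> \<theta>}"
    using assms by (simp add: card_image count_le_def)
qed simp

section \<open>Exchanging a single p-value\<close>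

text \<open>The p-values outside \<open>T\<close> are constrained only by joint independence.
  Uniformity of those in \<open>T\<close> enters through the distribution function.\<close>

locale null_pvalues = prob_space M
  for M :: "'a measure" and p :: "nat \<Rightarrow> 'a \<Rightarrow> real" and I T :: "nat set" +
  assumes finite_I: "finite I" and T_subset: "T \<subseteq> I"
    and indep: "indep_vars (\<lambda>_. borel) p I"
    and prob_le: "\<And>i \<theta>. i \<in> T \<Longrightarrow> 0 \<le> \<theta> \<Longrightarrow> \<theta> \<le> 1 \<Longrightarrow> prob {\<omega> \<in> space M. p i \<omega> \<le> \<theta>} = \<theta>"
begin

lemma finite_T: "finite T"
  using finite_I T_subset by (rule finite_subset[rotated])

lemma rv: "i \<in> I \<Longrightarrow> p i \<in> borel_measurable M"
  using indep by (simp add: indep_vars_def)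

text \<open>Restricting to \<open>I\<close> yields a point of the product space on which
  \<open>obs\<close> is stated.\<close>

definition pvec :: "'a \<Rightarrow> nat \<Rightarrow> real" where
  "pvec \<omega> = (\<lambda>i\<in>I. p i \<omega>)"

text \<open>Events are predicates on vectors of p-values rather than on outcomes, so that a single
  coordinate can be overwritten.\<close>

definition pr :: "((nat \<Rightarrow> real) \<Rightarrow> bool) \<Rightarrow> real" where
  "pr E = prob {\<omega> \<in> space M. E (pvec \<omega>)}"

lemma pvec_apply: "i \<in> I \<Longrightarrow> pvec \<omega> i = p i \<omega>"
  by (simp add: pvec_def)

abbreviation obs :: "((nat \<Rightarrow> real) \<Rightarrow> bool) \<Rightarrow> bool" where
  "obs E \<equiv> Measurable.pred (PiM I (\<lambda>_. borel)) E"

lemma pvec_measurable [measurable]: "pvec \<in> measurable M (PiM I (\<lambda>_. borel))"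
  unfolding pvec_def using rv by (intro measurable_restrict) auto

lemma obs_sets [measurable]: "obs E \<Longrightarrow> {\<omega> \<in> space M. E (pvec \<omega>)} \<in> sets M"
  using measurable_compose[OF pvec_measurable] unfolding pred_def[symmetric] by blast

lemma obs_count_le [measurable]:
  assumes "S \<subseteq> I"
  shows "(\<lambda>q. count_le S q \<theta>) \<in> measurable (PiM I (\<lambda>_. borel)) (count_space UNIV)"
  unfolding count_le_def
proof (rule measurable_card)
  fix i
  show "{q \<in> space (PiM I (\<lambda>_. borel)). i \<in> {i \<in> S. q i \<le> \<theta>}} \<in> sets (PiM I (\<lambda>_. borel))"
  proof (cases "i \<in> S")
    case True
    then have [measurable]: "(\<lambda>q. q i) \<in> borel_measurable (PiM I (\<lambda>_. borel :: real measure))"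
      using assms by (intro measurable_component_singleton) auto
    show ?thesis using True by simp
  qed simp
qed

lemma pr_nonneg: "0 \<le> pr E"
  by (simp add: pr_def)

lemma pr_mono: "obs F \<Longrightarrow> (\<And>q. E q \<Longrightarrow> F q) \<Longrightarrow> pr E \<le> pr F"
  unfolding pr_def by (rule finite_measure_mono) auto

lemma pr_split:
  assumes "obs E" "finite B" "\<And>b. b \<in> B \<Longrightarrow> obs (\<lambda>q. E q \<and> f q = b)" "\<And>q. E q \<Longrightarrow> f q \<in> B"
  shows "pr E = (\<Sum>b\<in>B. pr (\<lambda>q. E q \<and> f q = b))"
proof -
  have "(\<Sum>b\<in>B. pr (\<lambda>q. E q \<and> f q = b)) = prob (\<Union>b\<in>B. {\<omega> \<in> space M. E (pvec \<omega>) \<and> f (pvec \<omega>) = b})"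
    unfolding pr_def using assms(2) obs_sets[OF assms(3)]
    by (intro finite_measure_finite_Union[symmetric]) (auto simp: disjoint_family_on_def)
  also have "(\<Union>b\<in>B. {\<omega> \<in> space M. E (pvec \<omega>) \<and> f (pvec \<omega>) = b}) = {\<omega> \<in> space M. E (pvec \<omega>)}"
    using assms(4) by auto
  finally show ?thesis by (simp add: pr_def)
qed

text \<open>Once coordinate \<open>i\<close> is overwritten, \<open>E\<close> depends only on the
  coordinates in \<open>I - {i}\<close>, and independence makes the probability factor.\<close>

lemma leave_one_out:
  assumes i: "i \<in> I" and X: "X \<in> sets borel" and E: "obs E"
  shows "pr (\<lambda>q. q i \<in> X \<and> E (q(i := v))) = prob {\<omega> \<in> space M. p i \<omega> \<in> X} * pr (\<lambda>q. E (q(i := v)))"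
proof -
  let ?P = "\<lambda>A. PiM A (\<lambda>_. borel :: real measure)"
  have upd: "(\<lambda>g. g(i := v)) \<in> measurable (?P (I - {i})) (?P I)"
    using i by (intro measurable_fun_upd[where J = "I - {i}"]) auto
  let ?A = "{g \<in> space (?P {i}). g i \<in> X}" and ?B = "{g \<in> space (?P (I - {i})). E (g(i := v))}"
  have "(\<lambda>g. g i) \<in> borel_measurable (?P {i})"
    by (intro measurable_component_singleton) auto
  then have A: "?A \<in> sets (?P {i})"
    using X by measurable
  have B: "?B \<in> sets (?P (I - {i}))"
    using E upd by measurable
  have upd_restrict: "(\<lambda>j\<in>I - {i}. p j \<omega>)(i := v) = (pvec \<omega>)(i := v)" for \<omega>
    using i by (auto simp: pvec_def fun_eq_iff)
  have "indep_var (?P {i}) (\<lambda>\<omega>. \<lambda>j\<in>{i}. p j \<omega>) (?P (I - {i})) (\<lambda>\<omega>. \<lambda>j\<in>I - {i}. p j \<omega>)"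
    using i by (intro indep_var_restrict[OF indep]) auto
  from indep_varD[OF this A B] show ?thesis
    using i by (simp add: pr_def vimage_def Int_def upd_restrict pvec_apply space_PiM conj_commute)
qed

text \<open>
  Freezing coordinate \<open>i\<close> at a representative value \<open>v\<close> of \<open>Y\<close> turns \<open>E'\<close> into an event that is
  independent of \<open>p i\<close>.
\<close>

lemma exchange_single:
  assumes i: "i \<in> I" and X: "X \<in> sets borel" and Y: "Y \<in> sets borel" and E: "obs E" "obs E'"
    and move: "\<And>q. q i \<in> X \<Longrightarrow> E q \<Longrightarrow> E' (q(i := v))"
    and restore: "\<And>q. q i \<in> Y \<Longrightarrow> E' (q(i := v)) \<Longrightarrow> E' q"
  shows "prob {\<omega> \<in> space M. p i \<omega> \<in> Y} * pr (\<lambda>q. E q \<and> q i \<in> X)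
       \<le> prob {\<omega> \<in> space M. p i \<omega> \<in> X} * pr (\<lambda>q. E' q \<and> q i \<in> Y)"
proof -
  have [measurable]: "(\<lambda>q. q i) \<in> borel_measurable (PiM I (\<lambda>_. borel :: real measure))"
    using i by (intro measurable_component_singleton) auto
  have upd [measurable]: "(\<lambda>q. q(i := v)) \<in> measurable (PiM I (\<lambda>_. borel)) (PiM I (\<lambda>_. borel :: real measure))"
    using i by (intro measurable_fun_upd[where J = I]) auto
  note [measurable] = X Y E
  let ?X = "prob {\<omega> \<in> space M. p i \<omega> \<in> X}" and ?Y = "prob {\<omega> \<in> space M. p i \<omega> \<in> Y}"
  have "?Y * pr (\<lambda>q. E q \<and> q i \<in> X) \<le> ?Y * pr (\<lambda>q. q i \<in> X \<and> E' (q(i := v)))"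
    using move by (intro mult_left_mono pr_mono) auto
  also have "\<dots> = ?X * pr (\<lambda>q. q i \<in> Y \<and> E' (q(i := v)))"
    unfolding leave_one_out[OF i X E(2)] leave_one_out[OF i Y E(2)] by simp
  also have "\<dots> \<le> ?X * pr (\<lambda>q. E' q \<and> q i \<in> Y)"
    using restore by (intro mult_left_mono pr_mono) auto
  finally show ?thesis .
qed

text \<open>Double counting: on \<open>E\<close> exactly \<open>c\<close> of the indicators over
  \<open>i \<in> T\<close> equal 1, so the identity is linearity of expectation.\<close>

lemma sum_pr_mem:
  assumes X: "X \<in> sets borel" and E: "obs E" and c: "\<And>q. E q \<Longrightarrow> card {i \<in> T. q i \<in> X} = c"
  shows "(\<Sum>i\<in>T. pr (\<lambda>q. E q \<and> q i \<in> X)) = real c * pr E"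
proof -
  have [measurable]: "{\<omega> \<in> space M. E (pvec \<omega>) \<and> pvec \<omega> i \<in> X} \<in> sets M" if "i \<in> T" for i
  proof -
    have "(\<lambda>q. q i) \<in> borel_measurable (PiM I (\<lambda>_. borel :: real measure))"
      using that T_subset by (intro measurable_component_singleton) auto
    then show ?thesis using X E by measurable
  qed
  have "(\<Sum>i\<in>T. pr (\<lambda>q. E q \<and> q i \<in> X))
      = (\<Sum>i\<in>T. expectation (indicator {\<omega> \<in> space M. E (pvec \<omega>) \<and> pvec \<omega> i \<in> X}))"
    unfolding pr_def by (intro sum.cong refl) simp
  also have "\<dots> = expectation (\<lambda>\<omega>. \<Sum>i\<in>T. indicator {\<omega> \<in> space M. E (pvec \<omega>) \<and> pvec \<omega> i \<in> X} \<omega>)"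
    by (intro Bochner_Integration.integral_sum[symmetric]) (auto simp: integrable_indicator_iff emeasure_eq_measure)
  also have "\<dots> = expectation (\<lambda>\<omega>. real c * indicator {\<omega> \<in> space M. E (pvec \<omega>)} \<omega>)"
  proof (intro Bochner_Integration.integral_cong refl)
    fix \<omega> assume \<omega>: "\<omega> \<in> space M"
    have "(\<Sum>i\<in>T. indicator {\<omega> \<in> space M. E (pvec \<omega>) \<and> pvec \<omega> i \<in> X} \<omega> :: real)
        = (\<Sum>i\<in>T. if E (pvec \<omega>) \<and> pvec \<omega> i \<in> X then 1 else 0)"
      using \<omega> by (intro sum.cong) (auto simp: indicator_def)
    also have "\<dots> = real (card {i \<in> T. E (pvec \<omega>) \<and> pvec \<omega> i \<in> X})"
      using finite_T by (simp add: sum.If_cases Int_def)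
    also have "\<dots> = real c * indicator {\<omega> \<in> space M. E (pvec \<omega>)} \<omega>"
      using \<omega> c[of "pvec \<omega>"] by (auto simp: indicator_def)
    finally show "(\<Sum>i\<in>T. indicator {\<omega> \<in> space M. E (pvec \<omega>) \<and> pvec \<omega> i \<in> X} \<omega>)
        = real c * indicator {\<omega> \<in> space M. E (pvec \<omega>)} \<omega>" .
  qed
  also have "\<dots> = real c * pr E"
    using obs_sets[OF E] by (simp add: pr_def)
  finally show ?thesis .
qed

text \<open>Summing the single exchange over \<open>i \<in> T\<close> counts the coordinates that
  can be moved: on \<open>E\<close>, \<open>c\<close> of them lie in \<open>X\<close>; on
  \<open>E'\<close>, \<open>d\<close> of them lie in \<open>Y\<close>. Choosing events that differ
  by one in a count gives recursions for count probabilities.\<close>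

lemma exchange:
  assumes XY: "X \<in> sets borel" "Y \<in> sets borel" and E: "obs E" "obs E'"
    and move: "\<And>q i. i \<in> T \<Longrightarrow> q i \<in> X \<Longrightarrow> E q \<Longrightarrow> E' (q(i := v))"
    and restore: "\<And>q i. i \<in> T \<Longrightarrow> q i \<in> Y \<Longrightarrow> E' (q(i := v)) \<Longrightarrow> E' q"
    and prob: "\<And>i. i \<in> T \<Longrightarrow> prob {\<omega> \<in> space M. p i \<omega> \<in> X} = a"
      "\<And>i. i \<in> T \<Longrightarrow> prob {\<omega> \<in> space M. p i \<omega> \<in> Y} = b"
    and card: "\<And>q. E q \<Longrightarrow> card {i \<in> T. q i \<in> X} = c"
      "\<And>q. E' q \<Longrightarrow> card {i \<in> T. q i \<in> Y} = d"
  shows "real c * b * pr E \<le> real d * a * pr E'"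
proof -
  have s1: "(\<Sum>i\<in>T. pr (\<lambda>q. E q \<and> q i \<in> X)) = real c * pr E"
    by (rule sum_pr_mem[OF XY(1) E(1)]) (rule card(1))
  have s2: "(\<Sum>i\<in>T. pr (\<lambda>q. E' q \<and> q i \<in> Y)) = real d * pr E'"
    by (rule sum_pr_mem[OF XY(2) E(2)]) (rule card(2))
  have "real c * b * pr E = (\<Sum>i\<in>T. b * pr (\<lambda>q. E q \<and> q i \<in> X))"
    unfolding sum_distrib_left[symmetric] s1 by simp
  also have "\<dots> \<le> (\<Sum>i\<in>T. a * pr (\<lambda>q. E' q \<and> q i \<in> Y))"
  proof (rule sum_mono)
    fix i assume i: "i \<in> T"
    have "prob {\<omega> \<in> space M. p i \<omega> \<in> Y} * pr (\<lambda>q. E q \<and> q i \<in> X)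
        \<le> prob {\<omega> \<in> space M. p i \<omega> \<in> X} * pr (\<lambda>q. E' q \<and> q i \<in> Y)"
    proof (rule exchange_single[where v = v, OF _ XY E])
      show "i \<in> I" using i T_subset by auto
    qed (rule move[OF i] restore[OF i]; assumption)+
    then show "b * pr (\<lambda>q. E q \<and> q i \<in> X) \<le> a * pr (\<lambda>q. E' q \<and> q i \<in> Y)"
      by (simp add: prob[OF i])
  qed
  also have "\<dots> = real d * a * pr E'"
    unfolding sum_distrib_left[symmetric] s2 by simp
  finally show ?thesis .
qed

lemma prob_Ioc:
  assumes "i \<in> T" "0 \<le> s" "s \<le> t" "t \<le> 1"
  shows "prob {\<omega> \<in> space M. p i \<omega> \<in> {s<..t}} = t - s"
proof -
  have [measurable]: "p i \<in> borel_measurable M" using rv assms T_subset by auto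
  have "{\<omega> \<in> space M. p i \<omega> \<in> {s<..t}} = {\<omega> \<in> space M. p i \<omega> \<le> t} - {\<omega> \<in> space M. p i \<omega> \<le> s}"
    by auto
  also have "prob \<dots> = prob {\<omega> \<in> space M. p i \<omega> \<le> t} - prob {\<omega> \<in> space M. p i \<omega> \<le> s}"
    using assms by (intro finite_measure_Diff) auto
  finally show ?thesis using prob_le assms by simp
qed

lemma prob_Ioi:
  assumes "i \<in> T" "0 \<le> s" "s \<le> 1"
  shows "prob {\<omega> \<in> space M. p i \<omega> \<in> {s<..}} = 1 - s"
proof -
  have [measurable]: "p i \<in> borel_measurable M" using rv assms T_subset by auto
  have "{\<omega> \<in> space M. p i \<omega> \<in> {s<..}} = space M - {\<omega> \<in> space M. p i \<omega> \<le> s}"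
    by auto
  also have "prob \<dots> = 1 - prob {\<omega> \<in> space M. p i \<omega> \<le> s}"
    by (intro prob_compl) auto
  finally show ?thesis using prob_le assms by simp
qed

section \<open>Binomial thinning of the counts\<close>

abbreviation N :: "real \<Rightarrow> (nat \<Rightarrow> real) \<Rightarrow> nat" where
  "N s q \<equiv> count_le T q s"

lemma obs_N [measurable]: "obs (\<lambda>q. N s q = z)"
  using obs_count_le[OF T_subset, of s] by measurable

lemma N_mono: "s \<le> t \<Longrightarrow> N s q \<le> N t q"
  by (rule count_le_mono[OF finite_T])

lemma N_le_card: "N s q \<le> card T"
  by (rule count_le_le_card[OF finite_T])

lemma card_atMost_N: "card {i \<in> T. q i \<in> {..s}} = N s q"
  by (simp add: count_le_def)

lemma card_Ioc_N: "s \<le> t \<Longrightarrow> card {i \<in> T. q i \<in> {s<..t}} = N t q - N s q"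
  using card_between[OF finite_T, of s t q] by simp

lemma card_Ioi_N: "card {i \<in> T. q i \<in> {s<..}} = card T - N s q"
  using card_gt[OF finite_T, of s q] by simp

lemma prob_atMost: "i \<in> T \<Longrightarrow> 0 \<le> s \<Longrightarrow> s \<le> 1 \<Longrightarrow> prob {\<omega> \<in> space M. p i \<omega> \<in> {..s}} = s"
  using prob_le by simp

lemma pr_False: "(\<And>q. \<not> E q) \<Longrightarrow> pr E = 0"
  by (simp add: pr_def)

text \<open>Moving one null p-value between \<open>{..s}\<close> and \<open>{s<..t}\<close> changes
  \<open>N s\<close> by one and preserves \<open>E\<close> and \<open>N t\<close>. The two
  directions give the two inequalities.\<close>

lemma thinning_recursion:
  assumes st: "0 < s" "s \<le> t" "t \<le> 1" and E [measurable]: "obs E"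
    and inv: "\<And>q i v. i \<in> T \<Longrightarrow> q i \<le> t \<Longrightarrow> v \<le> t \<Longrightarrow> E q \<Longrightarrow> E (q(i := v))"
    and "z < y"
  shows "real (Suc z) * (t - s) * pr (\<lambda>q. (E q \<and> N t q = y) \<and> N s q = Suc z)
       = real (y - z) * s * pr (\<lambda>q. (E q \<and> N t q = y) \<and> N s q = z)"
proof (cases "s = t")
  \<comment> \<open>Here \<open>{s<..t}\<close> is empty and admits no exchange, but
    \<open>N s\<close> and \<open>N t\<close> agree, and both sides vanish.\<close>
  case True
  then have "pr (\<lambda>q. (E q \<and> N t q = y) \<and> N s q = z) = 0"
    using \<open>z < y\<close> by (intro pr_False) auto
  then show ?thesis using True by simp
next
  case False
  let ?E = "\<lambda>z q. (E q \<and> N t q = y) \<and> N s q = z"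
  have obs: "obs (?E z)" for z by measurable
  have inv': "E q" if "i \<in> T" "q i \<le> t" "v \<le> t" "E (q(i := v))" for q i v
    using inv[of i "q(i := v)" "q i"] that by simp
  have "real (Suc z) * (t - s) * pr (?E (Suc z)) \<le> real (y - z) * s * pr (?E z)"
  proof (rule exchange[where X = "{..s}" and Y = "{s<..t}" and v = t])
    show "?E z (q(i := t))" if "i \<in> T" "q i \<in> {..s}" "?E (Suc z) q" for q i
      using that st False inv[of i q t] count_le_upd_same[of i T q t t]
        count_le_upd_pred[OF finite_T, of i q s t] by auto
    show "?E z q" if "i \<in> T" "q i \<in> {s<..t}" "?E z (q(i := t))" for q i
      using that st False inv'[of i q t] count_le_upd_same[of i T q t t]
        count_le_upd_same[of i T q s t] by auto
  qed (use st obs in \<open>auto simp: card_atMost_N card_Ioc_N prob_Ioc prob_atMost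
    simp del: greaterThanAtMost_iff atMost_iff\<close>)
  moreover have "real (y - z) * s * pr (?E z) \<le> real (Suc z) * (t - s) * pr (?E (Suc z))"
  proof (rule exchange[where X = "{s<..t}" and Y = "{..s}" and v = s])
    show "?E (Suc z) (q(i := s))" if "i \<in> T" "q i \<in> {s<..t}" "?E z q" for q i
      using that st False inv[of i q s] count_le_upd_same[of i T q t s]
        count_le_upd_Suc[OF finite_T, of i s q s] by auto
    show "?E (Suc z) q" if "i \<in> T" "q i \<in> {..s}" "?E (Suc z) (q(i := s))" for q i
      using that st False inv'[of i q s] count_le_upd_same[of i T q t s]
        count_le_upd_same[of i T q s s] by auto
  qed (use st obs in \<open>auto simp: card_atMost_N card_Ioc_N prob_Ioc prob_atMost
    simp del: greaterThanAtMost_iff atMost_iff\<close>)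
  ultimately show ?thesis by (rule antisym)
qed

text \<open>Given \<open>E\<close> and \<open>N t = y\<close>, the count \<open>N s\<close> is
  binomial with parameters \<open>y\<close> and \<open>s / t\<close>: the recursion determines the
  law up to scale, and \<open>N s \<le> N t\<close> confines it to values up to
  \<open>y\<close>.\<close>

lemma thinning:
  assumes st: "0 < s" "s \<le> t" "t \<le> 1" and E [measurable]: "obs E"
    and inv: "\<And>q i v. i \<in> T \<Longrightarrow> q i \<le> t \<Longrightarrow> v \<le> t \<Longrightarrow> E q \<Longrightarrow> E (q(i := v))"
  shows "pr (\<lambda>q. (E q \<and> N t q = y) \<and> N s q = z)
       = real (y choose z) * (s / t) ^ z * (1 - s / t) ^ (y - z) * pr (\<lambda>q. E q \<and> N t q = y)"
proof (cases "z \<le> y")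
  case True
  have "pr (\<lambda>q. E q \<and> N t q = y) = (\<Sum>w\<le>y. pr (\<lambda>q. (E q \<and> N t q = y) \<and> N s q = w))"
  proof (rule pr_split)
    show "N s q \<in> {..y}" if "E q \<and> N t q = y" for q
      using that N_mono[OF st(2), of q] by simp
  qed auto
  moreover have "pr (\<lambda>q. (E q \<and> N t q = y) \<and> N s q = z)
      = real (y choose z) * (s / t) ^ z * (1 - s / t) ^ (y - z)
        * (\<Sum>w\<le>y. pr (\<lambda>q. (E q \<and> N t q = y) \<and> N s q = w))"
    using True
    by (intro binomial_weight_unique st(1,2) pr_nonneg thinning_recursion st E inv)
  ultimately show ?thesis by simp
next
  case False
  have "pr (\<lambda>q. (E q \<and> N t q = y) \<and> N s q = z) = 0"
  proof (rule pr_False)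
    show "\<not> ((E q \<and> N t q = y) \<and> N s q = z)" for q
      using N_mono[OF st(2), of q] False by auto
  qed
  then show ?thesis using False by simp
qed

text \<open>
  The expectation of \<open>N s * I (N s \<ge> k)\<close> on the event \<open>E\<close>.
\<close>

definition moment :: "nat \<Rightarrow> ((nat \<Rightarrow> real) \<Rightarrow> bool) \<Rightarrow> real \<Rightarrow> real" where
  "moment k E s = (\<Sum>z=k..card T. real z * pr (\<lambda>q. E q \<and> N s q = z))"

lemma moment_nonneg: "0 \<le> moment k E s"
  unfolding moment_def by (intro sum_nonneg mult_nonneg_nonneg pr_nonneg) auto

lemma moment_mono:
  assumes [measurable]: "obs F" and "\<And>q. E q \<Longrightarrow> F q"
  shows "moment k E s \<le> moment k F s"
  unfolding moment_def using assms(2)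
  by (intro sum_mono mult_left_mono pr_mono) auto

text \<open>Splitting by the value of \<open>N t\<close> reduces the moment to truncated binomial
  means.\<close>

lemma moment_thinning:
  assumes st: "0 < s" "s \<le> t" "t \<le> 1" and E [measurable]: "obs E"
    and inv: "\<And>q i v. i \<in> T \<Longrightarrow> q i \<le> t \<Longrightarrow> v \<le> t \<Longrightarrow> E q \<Longrightarrow> E (q(i := v))"
    and k: "1 \<le> k"
  shows "moment k E s = (\<Sum>y\<le>card T. pr (\<lambda>q. E q \<and> N t q = y)
           * (real y * (s / t) * binom_tail (k - 1) (y - 1) (s / t)))"
proof -
  let ?b = "\<lambda>y z. real (y choose z) * (s / t) ^ z * (1 - s / t) ^ (y - z)"
  have "pr (\<lambda>q. E q \<and> N s q = z) = (\<Sum>y\<le>card T. ?b y z * pr (\<lambda>q. E q \<and> N t q = y))" for z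
  proof -
    have "pr (\<lambda>q. E q \<and> N s q = z) = (\<Sum>y\<le>card T. pr (\<lambda>q. (E q \<and> N s q = z) \<and> N t q = y))"
      by (rule pr_split) (auto intro: N_le_card)
    also have "\<dots> = (\<Sum>y\<le>card T. pr (\<lambda>q. (E q \<and> N t q = y) \<and> N s q = z))"
      by (intro sum.cong refl arg_cong[where f = pr]) auto
    also have "\<dots> = (\<Sum>y\<le>card T. ?b y z * pr (\<lambda>q. E q \<and> N t q = y))"
      by (intro sum.cong refl thinning st E inv)
    finally show ?thesis .
  qed
  then have "moment k E s
      = (\<Sum>z=k..card T. \<Sum>y\<le>card T. pr (\<lambda>q. E q \<and> N t q = y) * (real z * ?b y z))"
    unfolding moment_def by (simp add: sum_distrib_left mult.commute mult.left_commute)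
  also have "\<dots> = (\<Sum>y\<le>card T. pr (\<lambda>q. E q \<and> N t q = y) * (\<Sum>z=k..card T. real z * ?b y z))"
    by (subst sum.swap) (simp add: sum_distrib_left)
  also have "\<dots> = (\<Sum>y\<le>card T. pr (\<lambda>q. E q \<and> N t q = y)
      * (real y * (s / t) * binom_tail (k - 1) (y - 1) (s / t)))"
    by (intro sum.cong refl arg_cong2[where f = "(*)"] sum_binomial_ge k) auto
  finally show ?thesis .
qed

text \<open>Thinning from level \<open>L\<close>, where a single value \<open>x\<close> survives.
  With \<open>n\<close> in place of \<open>x\<close>, the last two factors form
  \<open>G_tilde k n (s / L)\<close>, the quantity that the thresholds control.\<close>

lemma moment_fixed_count:
  assumes s: "0 < s" "s \<le> L" "L \<le> 1" and E: "obs E"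
    and inv: "\<And>q i v. i \<in> T \<Longrightarrow> q i \<le> L \<Longrightarrow> v \<le> L \<Longrightarrow> E q \<Longrightarrow> E (q(i := v))"
    and k: "1 \<le> k" and x: "x \<le> card T" "\<And>q. E q \<Longrightarrow> N L q = x"
  shows "moment k E s = pr E * (real x * (s / L) * binom_tail (k - 1) (x - 1) (s / L))"
proof -
  have "pr (\<lambda>q. E q \<and> N L q = y) = (if y = x then pr E else 0)" for y
    using x(2) by (auto intro: pr_False arg_cong[where f = pr])
  note pr = this
  let ?c = "\<lambda>y. real y * (s / L) * binom_tail (k - 1) (y - 1) (s / L)"
  have "moment k E s = (\<Sum>y\<le>card T. pr (\<lambda>q. E q \<and> N L q = y) * ?c y)"
    by (rule moment_thinning) (use s E inv k in auto)
  also have "\<dots> = (\<Sum>y\<le>card T. if y = x then pr E * ?c y else 0)"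
    unfolding pr by (intro sum.cong) auto
  also have "\<dots> = pr E * ?c x"
    using x(1) by simp
  finally show ?thesis .
qed

text \<open>
  Given \<open>N L = x\<close>, both the conditional probability of \<open>E\<close> (compare \<open>a_rec\<close> with \<open>b_rec\<close>) and the
  chance that the thinned count \<open>N s\<close> reaches \<open>k\<close> increase with \<open>N t\<close>, so they are positively
  correlated.
\<close>

lemma moment_cross:
  assumes st: "0 < s" "s \<le> t" "t \<le> L" "L \<le> 1" and E [measurable]: "obs E"
    and stable: "\<And>q i v. i \<in> T \<Longrightarrow> q i \<le> L \<Longrightarrow> v \<le> t \<Longrightarrow> E q \<Longrightarrow> E (q(i := v))"
    and k: "1 \<le> k" and x: "\<And>q. E q \<Longrightarrow> N L q = x"
  shows "moment k E t * moment k (\<lambda>q. N L q = x) s \<le> moment k E s * moment k (\<lambda>q. N L q = x) t"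
proof -
  let ?F = "\<lambda>q. N L q = x"
  define a where "a y = pr (\<lambda>q. E q \<and> N t q = y)" for y
  define b where "b y = pr (\<lambda>q. ?F q \<and> N t q = y)" for y
  \<comment> \<open>The weight \<open>w\<close> carries the truncation at \<open>k\<close>. Next to
    \<open>g\<close>, which vanishes for \<open>0 < y < k\<close>, it may be replaced by
    \<open>y\<close> itself; this is \<open>shape\<close>.\<close>
  define w where "w y = (if k \<le> y then real y else 0)" for y
  define r where "r = s / t"
  define g where "g y = binom_tail (k - 1) (y - 1) r" for y
  have r: "0 < r" "r \<le> 1" using st by (auto simp: r_def)
  have obs_a: "obs (\<lambda>q. E q \<and> N t q = y)" for y by measurable
  have obs_b: "obs (\<lambda>q. ?F q \<and> N t q = y)" for y by measurable
  \<comment> \<open>Only changes to values at most \<open>t\<close> are known to preserve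
    \<open>E\<close>, so one direction of exchange is available.\<close>
  have a_rec: "real (x - y) * t * a y \<le> real (Suc y) * (L - t) * a (Suc y)" for y
    unfolding a_def
  proof (rule exchange[where X = "{t<..L}" and Y = "{..t}" and v = t])
    show "E (q(i := t)) \<and> N t (q(i := t)) = Suc y"
      if "i \<in> T" "q i \<in> {t<..L}" "E q \<and> N t q = y" for q i
      using that st stable[of i q t] count_le_upd_Suc[OF finite_T, of i t q t] by auto
    show "E q \<and> N t q = Suc y" if "i \<in> T" "q i \<in> {..t}"
      "E (q(i := t)) \<and> N t (q(i := t)) = Suc y" for q i
      using that st stable[of i "q(i := t)" "q i"] count_le_upd_same[of i T q t t] by auto
  qed (use st obs_a x in \<open>auto simp: card_atMost_N card_Ioc_N prob_Ioc prob_atMost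
    simp del: greaterThanAtMost_iff atMost_iff\<close>)
  \<comment> \<open>The reference event admits the opposite exchange, since moves within
    \<open>{..L}\<close> do not affect \<open>N L\<close>.\<close>
  have b_rec: "real (Suc y) * (L - t) * b (Suc y) \<le> real (x - y) * t * b y" for y
  proof (cases "t = L")
    case True
    then show ?thesis using st by (simp add: b_def pr_nonneg)
  next
    case False
    show ?thesis unfolding b_def
    proof (rule exchange[where X = "{..t}" and Y = "{t<..L}" and v = L])
      show "?F (q(i := L)) \<and> N t (q(i := L)) = y"
        if "i \<in> T" "q i \<in> {..t}" "?F q \<and> N t q = Suc y" for q i
        using that st False count_le_upd_pred[OF finite_T, of i q t L]
          count_le_upd_same[of i T q L L] by auto
      show "?F q \<and> N t q = y" if "i \<in> T" "q i \<in> {t<..L}"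
        "?F (q(i := L)) \<and> N t (q(i := L)) = y" for q i
        using that st False count_le_upd_same[of i T q t L] count_le_upd_same[of i T q L L] by auto
    qed (use st obs_b in \<open>auto simp: card_atMost_N card_Ioc_N prob_Ioc prob_atMost
      simp del: greaterThanAtMost_iff atMost_iff\<close>)
  qed
  have zero: "a y = 0" "b y = 0" if "x < y" for y
  proof -
    have "N t q \<noteq> y" if "N L q = x" for q
      using that \<open>x < y\<close> N_mono[OF st(3), of q] by auto
    then show "a y = 0" "b y = 0"
      unfolding a_def b_def using x by (auto intro!: pr_False)
  qed
  have cross: "a y * b z \<le> a z * b y" if "y \<le> z" for y z
  proof (cases "z \<le> x")
    case True
    show ?thesis
    proof (rule ratio_cross_le[where c = "L - t" and d = t, OF _ _ _ _ a_rec b_rec that True])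
    qed (use st in \<open>auto simp: a_def b_def pr_nonneg\<close>)
  qed (use zero in auto)
  have shape: "w y * g y = real y * g y" for y
    using k by (cases "y = 0") (auto simp: w_def g_def binom_tail_eq_0)
  have Et: "moment k E t = (\<Sum>y\<le>card T. w y * a y)" "moment k ?F t = (\<Sum>y\<le>card T. w y * b y)"
    unfolding moment_def a_def b_def w_def
    by (rule sum.mono_neutral_cong_left; auto)+
  have "moment k E s = (\<Sum>y\<le>card T. a y * (real y * r * g y))"
    unfolding a_def r_def g_def
    by (rule moment_thinning) (use st k E stable in auto)
  then have Es: "moment k E s = r * (\<Sum>y\<le>card T. w y * g y * a y)"
    unfolding shape by (simp add: sum_distrib_left ac_simps)
  have "moment k ?F s = (\<Sum>y\<le>card T. b y * (real y * r * g y))"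
    unfolding b_def r_def g_def
  proof (rule moment_thinning)
    show "N L (q(i := v)) = x" if "i \<in> T" "q i \<le> t" "v \<le> t" "N L q = x" for q i v
      using that st count_le_upd_same[of i T q L v] by auto
  qed (use st k in auto)
  then have Fs: "moment k ?F s = r * (\<Sum>y\<le>card T. w y * g y * b y)"
    unfolding shape by (simp add: sum_distrib_left ac_simps)
  have "(\<Sum>y\<le>card T. w y * a y) * (\<Sum>y\<le>card T. w y * g y * b y)
      \<le> (\<Sum>y\<le>card T. w y * g y * a y) * (\<Sum>y\<le>card T. w y * b y)"
  proof (rule sum_cross_Chebyshev)
    show "g y \<le> g z" if "y \<le> z" for y z
      unfolding g_def using r that by (intro binom_tail_mono) auto
  qed (auto simp: w_def cross)
  from mult_left_mono[OF this, of r] show ?thesis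
    unfolding Et Es Fs using r by (simp add: ac_simps)
qed

text \<open>One exchange across level \<open>L\<close>, with \<open>v = 1\<close> lying above it,
  compares neighbouring values of \<open>N L\<close>. It later absorbs the factor
  \<open>(1 - L) / L\<close>.\<close>

lemma pr_count_shift:
  assumes L: "0 < L" "L < 1" and "x < card T"
  shows "real (Suc x) * (1 - L) * pr (\<lambda>q. N L q = Suc x) \<le> real (card T - x) * L * pr (\<lambda>q. N L q = x)"
proof (rule exchange[where X = "{..L}" and Y = "{L<..}" and v = 1])
  show "N L (q(i := 1)) = x" if "i \<in> T" "q i \<in> {..L}" "N L q = Suc x" for q i
    using that L count_le_upd_pred[OF finite_T, of i q L 1] by auto
  show "N L q = x" if "i \<in> T" "q i \<in> {L<..}" "N L (q(i := 1)) = x" for q i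
    using that L count_le_upd_same[of i T q L 1] by auto
qed (use L in \<open>auto simp: card_atMost_N card_Ioi_N prob_Ioi prob_atMost
    simp del: greaterThan_iff atMost_iff\<close>)

section \<open>Telescoping over the number of rejections\<close>

lemma pr_diff:
  assumes [measurable]: "obs E" "obs F" and "\<And>q. F q \<Longrightarrow> E q"
  shows "pr (\<lambda>q. E q \<and> \<not> F q) = pr E - pr F"
proof -
  have "{\<omega> \<in> space M. E (pvec \<omega>) \<and> \<not> F (pvec \<omega>)}
      = {\<omega> \<in> space M. E (pvec \<omega>)} - {\<omega> \<in> space M. F (pvec \<omega>)}" by auto
  then show ?thesis
    unfolding pr_def using obs_sets[OF assms(1)] obs_sets[OF assms(2)] assms(3)
    by (simp only:) (intro finite_measure_Diff; auto)
qed

text \<open>Used with events of at least \<open>r\<close> and at least \<open>r + 1\<close>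
  rejections, whose difference isolates exactly \<open>r\<close>.\<close>

lemma moment_diff:
  assumes [measurable]: "obs E" "obs F" and "\<And>q. F q \<Longrightarrow> E q"
  shows "(\<Sum>z=k..card T. real z * pr (\<lambda>q. (E q \<and> \<not> F q) \<and> N s q = z)) = moment k E s - moment k F s"
  unfolding moment_def sum_subtractf[symmetric]
proof (intro sum.cong refl)
  fix z
  have "pr (\<lambda>q. (E q \<and> \<not> F q) \<and> N s q = z)
      = pr (\<lambda>q. (E q \<and> N s q = z) \<and> \<not> (F q \<and> N s q = z))"
    by (intro arg_cong[where f = pr]) auto
  also have "\<dots> = pr (\<lambda>q. E q \<and> N s q = z) - pr (\<lambda>q. F q \<and> N s q = z)"
    by (rule pr_diff) (use assms(3) in auto)
  finally show "real z * pr (\<lambda>q. (E q \<and> \<not> F q) \<and> N s q = z)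
      = real z * pr (\<lambda>q. E q \<and> N s q = z) - real z * pr (\<lambda>q. F q \<and> N s q = z)"
    by (simp add: right_diff_distrib)
qed

text \<open>By \<open>moment_cross\<close>, \<open>moment k (A (Suc r)) (c r) / e r\<close> is at
  least \<open>moment k (A (Suc r)) (c (Suc r)) / e (Suc r)\<close>. Replacing the subtracted term
  by the latter makes the sum telescope; the term at 1 that remains is at most \<open>pr F\<close>
  because \<open>A 1\<close> implies \<open>F\<close>.\<close>

lemma moment_telescope:
  fixes c :: "nat \<Rightarrow> real"
  assumes L: "0 < L" "L \<le> 1" and k: "1 \<le> k" and x: "k \<le> x" "x \<le> card T"
    and c: "\<And>r. r \<in> {1..j} \<Longrightarrow> 0 < c r \<and> c r \<le> L" "\<And>r. r \<in> {1..<j} \<Longrightarrow> c r \<le> c (Suc r)"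
    and obs: "\<And>r. obs (A r)" "obs F"
    and F: "\<And>q. F q \<Longrightarrow> N L q = x"
      "\<And>q i v. i \<in> T \<Longrightarrow> q i \<le> L \<Longrightarrow> v \<le> L \<Longrightarrow> F q \<Longrightarrow> F (q(i := v))"
    and A: "\<And>r q. A r q \<Longrightarrow> F q" "\<And>q. \<not> A (Suc j) q"
      "\<And>r q i v. r \<in> {1..j} \<Longrightarrow> i \<in> T \<Longrightarrow> q i \<le> L \<Longrightarrow> v \<le> c r \<Longrightarrow> A r q \<Longrightarrow> A r (q(i := v))"
  defines "e \<equiv> \<lambda>r. real x * (c r / L) * binom_tail (k - 1) (x - 1) (c r / L)"
  shows "(\<Sum>r=1..j. (moment k (A r) (c r) - moment k (A (Suc r)) (c r)) / e r) \<le> pr F"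
proof -
  let ?G = "\<lambda>q. N L q = x"
  have e: "0 < e r" if "r \<in> {1..j}" for r
    unfolding e_def using c(1)[OF that] k x L by (intro mult_pos_pos binom_tail_pos) auto
  \<comment> \<open>The moments of the reference event share the factor \<open>pr ?G\<close>, so in
    \<open>moment_cross\<close> they can be replaced by \<open>e r\<close> and
    \<open>e (Suc r)\<close>.\<close>
  have Ge: "moment k ?G (c r) = pr ?G * e r" if "r \<in> {1..j}" for r
    unfolding e_def
  proof (rule moment_fixed_count)
    show "N L (q(i := v)) = x" if "i \<in> T" "q i \<le> L" "v \<le> L" "N L q = x" for q i v
      using that count_le_upd_same[of i T q L v] by auto
  qed (use c(1)[OF that] L k x in auto)
  have Fe: "moment k F (c r) = pr F * e r" if "r \<in> {1..j}" for r
    unfolding e_def by (rule moment_fixed_count) (use c(1)[OF that] L k x obs F in auto)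
  \<comment> \<open>The value is 0 beyond \<open>j\<close>, where the event is empty and the
    thresholds are unconstrained.\<close>
  define h where "h r = (if r \<le> j then moment k (A r) (c r) / e r else 0)" for r
  have step: "(moment k (A r) (c r) - moment k (A (Suc r)) (c r)) / e r \<le> h r - h (Suc r)"
    if r: "r \<in> {1..j}" for r
  proof (cases "r = j")
    case True
    then have "moment k (A (Suc r)) (c r) = 0"
      using A(2) unfolding moment_def by (intro sum.neutral ballI) (simp add: pr_False)
    then show ?thesis using True by (simp add: h_def)
  next
    case False
    with r have r': "Suc r \<in> {1..j}" "r \<in> {1..<j}" by auto
    have "h (Suc r) \<le> moment k (A (Suc r)) (c r) / e r"
    proof (cases "pr ?G = 0")
      \<comment> \<open>The factor \<open>pr ?G\<close> cannot be cancelled here, but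
        \<open>A (Suc r)\<close> lies inside \<open>?G\<close>, so its moments vanish.\<close>
      case True
      have "moment k (A (Suc r)) (c (Suc r)) \<le> moment k ?G (c (Suc r))"
        using A(1) F(1) by (intro moment_mono) auto
      then have "moment k (A (Suc r)) (c (Suc r)) \<le> 0"
        using Ge[OF r'(1)] True by simp
      then have "h (Suc r) \<le> 0"
        using e[OF r'(1)] by (auto simp: h_def divide_le_0_iff)
      also have "0 \<le> moment k (A (Suc r)) (c r) / e r"
        using e[OF r] moment_nonneg by (intro divide_nonneg_pos) auto
      finally show ?thesis .
    next
      case False
      then have pos: "0 < pr ?G" using pr_nonneg[of ?G] by simp
      have "moment k (A (Suc r)) (c (Suc r)) * moment k ?G (c r)
          \<le> moment k (A (Suc r)) (c r) * moment k ?G (c (Suc r))"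
        by (rule moment_cross)
          (use c(1)[OF r] c(1)[OF r'(1)] c(2)[OF r'(2)] L k obs A(1) F(1) A(3)[OF r'(1)] in auto)
      then have "pr ?G * (moment k (A (Suc r)) (c (Suc r)) * e r)
          \<le> pr ?G * (moment k (A (Suc r)) (c r) * e (Suc r))"
        unfolding Ge[OF r] Ge[OF r'(1)] by (simp only: ac_simps)
      then have "moment k (A (Suc r)) (c (Suc r)) * e r \<le> moment k (A (Suc r)) (c r) * e (Suc r)"
        using pos by simp
      then show ?thesis
        using e[OF r] e[OF r'(1)] r' by (simp add: h_def field_simps)
    qed
    then show ?thesis using r by (simp add: h_def diff_divide_distrib)
  qed
  have "(\<Sum>r=1..j. (moment k (A r) (c r) - moment k (A (Suc r)) (c r)) / e r) \<le> (\<Sum>r=1..j. h r - h (Suc r))"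
    by (intro sum_mono step)
  also have "\<dots> = h 1 - h (Suc j)"
    using sum_Suc_diff[of 1 j "\<lambda>r. - h r"] by simp
  also have "\<dots> = h 1" by (simp add: h_def)
  also have "h 1 \<le> pr F"
  proof (cases "1 \<le> j")
    case True
    then have 1: "1 \<in> {1..j}" by simp
    have "moment k (A 1) (c 1) \<le> pr F * e 1"
      unfolding Fe[OF 1, symmetric] using obs A(1) by (intro moment_mono) auto
    then show ?thesis
      using True e[OF 1] by (simp add: h_def pos_divide_le_eq)
  qed (simp add: h_def pr_nonneg)
  finally show ?thesis .
qed

text \<open>The bound on the thresholds says that \<open>?e r\<close> is at most
  \<open>r * \<beta> * x\<close>. Hence the weight \<open>1 / r\<close> of a false discovery
  proportion can be traded for \<open>\<beta> * x / ?e r\<close>, after which the sum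
  telescopes.\<close>

lemma weighted_moment_bound:
  fixes c :: "nat \<Rightarrow> real"
  assumes L: "0 < L" "L \<le> 1" and k: "1 \<le> k" and x: "k \<le> x" "x \<le> card T"
    and c: "\<And>r. r \<in> {1..j} \<Longrightarrow> 0 < c r \<and> c r \<le> L" "\<And>r. r \<in> {1..<j} \<Longrightarrow> c r \<le> c (Suc r)"
    and obs [measurable]: "\<And>r. obs (A r)" "obs F"
    and F: "\<And>q. F q \<Longrightarrow> N L q = x"
      "\<And>q i v. i \<in> T \<Longrightarrow> q i \<le> L \<Longrightarrow> v \<le> L \<Longrightarrow> F q \<Longrightarrow> F (q(i := v))"
    and A: "\<And>r q. A r q \<Longrightarrow> F q" "\<And>q. \<not> A (Suc j) q"
      "\<And>r q i v. r \<in> {1..j} \<Longrightarrow> i \<in> T \<Longrightarrow> q i \<le> L \<Longrightarrow> v \<le> c r \<Longrightarrow> A r q \<Longrightarrow> A r (q(i := v))"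
      "\<And>r q. A (Suc r) q \<Longrightarrow> A r q"
    and \<beta>: "0 \<le> \<beta>" "\<And>r. r \<in> {1..j} \<Longrightarrow> c r / L * binom_tail (k - 1) (x - 1) (c r / L) \<le> real r * \<beta>"
  shows "(\<Sum>r=1..j. \<Sum>z=k..card T. real z / real r * pr (\<lambda>q. (A r q \<and> \<not> A (Suc r) q) \<and> N (c r) q = z))
       \<le> \<beta> * real x * pr F"
proof -
  let ?e = "\<lambda>r. real x * (c r / L) * binom_tail (k - 1) (x - 1) (c r / L)"
  let ?m = "\<lambda>r. moment k (A r) (c r) - moment k (A (Suc r)) (c r)"
  have "(\<Sum>z=k..card T. real z / real r * pr (\<lambda>q. (A r q \<and> \<not> A (Suc r) q) \<and> N (c r) q = z))
      \<le> \<beta> * real x * (?m r / ?e r)" if r: "r \<in> {1..j}" for r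
  proof -
    have e: "0 < ?e r"
      using c(1)[OF r] k x L by (intro mult_pos_pos binom_tail_pos) auto
    have diff: "(\<Sum>z=k..card T. real z * pr (\<lambda>q. (A r q \<and> \<not> A (Suc r) q) \<and> N (c r) q = z)) = ?m r"
      by (rule moment_diff) (use obs A(4) in auto)
    have "moment k (A (Suc r)) (c r) \<le> moment k (A r) (c r)"
      by (rule moment_mono) (use obs A(4) in auto)
    note mono = this
    have "(\<Sum>z=k..card T. real z / real r * pr (\<lambda>q. (A r q \<and> \<not> A (Suc r) q) \<and> N (c r) q = z))
        = ?m r / real r"
      unfolding diff[symmetric] sum_divide_distrib by simp
    also have "\<dots> = (1 / real r) * ?m r" by simp
    also have "1 / real r \<le> \<beta> * real x / ?e r"
    proof -
      have "real x * (c r / L * binom_tail (k - 1) (x - 1) (c r / L)) \<le> real x * (real r * \<beta>)"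
        by (intro mult_left_mono) (use \<beta>(2)[OF r] in auto)
      then have le: "?e r \<le> real r * (\<beta> * real x)"
        by (simp only: ac_simps)
      have "1 / R \<le> b / E" if "0 < E" "0 < R" "E \<le> R * b" for E R b :: real
        using that by (simp add: field_simps)
      from this[OF e _ le] show ?thesis using r by simp
    qed
    then have "(1 / real r) * ?m r \<le> (\<beta> * real x / ?e r) * ?m r"
      using mono by (intro mult_right_mono) auto
    also have "\<dots> = \<beta> * real x * (?m r / ?e r)"
      by (simp only: times_divide_eq_left times_divide_eq_right)
    finally show ?thesis .
  qed
  then have "(\<Sum>r=1..j. \<Sum>z=k..card T. real z / real r * pr (\<lambda>q. (A r q \<and> \<not> A (Suc r) q) \<and> N (c r) q = z))
      \<le> \<beta> * real x * (\<Sum>r=1..j. ?m r / ?e r)"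
    unfolding sum_distrib_left by (rule sum_mono)
  also have "\<dots> \<le> \<beta> * real x * pr F"
    by (intro mult_left_mono mult_nonneg_nonneg \<beta>(1) moment_telescope)
      (use L k x c obs F A in auto)
  finally show ?thesis .
qed

text \<open>The exchange across \<open>L\<close> turns each summand into at most the probability of
  \<open>N L = x - 1\<close>, and these events are disjoint.\<close>

lemma shifted_count_sum:
  assumes L: "0 < L" "L < 1" and k: "1 \<le> k"
  shows "(\<Sum>x=k..card T. (1 - L) / L * (real x / real (card T - x + 1)) * pr (\<lambda>q. N L q = x)) \<le> 1"
proof -
  have "(\<Sum>x=k..card T. (1 - L) / L * (real x / real (card T - x + 1)) * pr (\<lambda>q. N L q = x))
      \<le> (\<Sum>x=k..card T. pr (\<lambda>q. N L q = x - 1))"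
  proof (rule sum_mono)
    fix x assume "x \<in> {k..card T}"
    then obtain y where y: "x = Suc y" "y < card T" using k by (cases x) auto
    then have "card T - x + 1 = card T - y" by simp
    then show "(1 - L) / L * (real x / real (card T - x + 1)) * pr (\<lambda>q. N L q = x) \<le> pr (\<lambda>q. N L q = x - 1)"
      using pr_count_shift[OF L y(2)] L y
      by (simp del: of_nat_Suc of_nat_diff add: field_simps)
  qed
  \<comment> \<open>All \<open>x\<close> are at least 1, so the truncated subtraction is injective
    on the range.\<close>
  also have "\<dots> = (\<Sum>y\<in>(\<lambda>x. x - 1) ` {k..card T}. pr (\<lambda>q. N L q = y))"
    using k by (subst sum.reindex) (auto simp: inj_on_def)
  also have "\<dots> \<le> (\<Sum>y\<le>card T. pr (\<lambda>q. True \<and> N L q = y))"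
    unfolding simp_thms by (intro sum_mono2) (auto simp: pr_nonneg)
  also have "\<dots> = pr (\<lambda>_. True)"
    by (rule pr_split[symmetric]) (auto simp: N_le_card)
  also have "\<dots> = 1" by (simp add: pr_def prob_space)
  finally show ?thesis .
qed

end

section \<open>Procedure 2 in terms of counts\<close>

text \<open>The level against which the second stage compares the \<open>r\<close>-th smallest
  p-value when \<open>j\<close> p-values are at most \<open>lam\<close>.\<close>

definition threshold :: "nat \<Rightarrow> nat \<Rightarrow> real \<Rightarrow> real \<Rightarrow> nat \<Rightarrow> nat \<Rightarrow> real" where
  "threshold k n \<alpha> lam j r =
     lam * capped_G_tilde_inv k n (real r * \<alpha> * (1 - lam) / (lam * (real n - real j + 1)))"

lemma threshold_bounds:
  assumes "1 \<le> k" "k \<le> n" "0 < \<alpha>" "0 < lam" "lam < 1" "1 \<le> r" "j \<le> n"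
  shows "0 < threshold k n \<alpha> lam j r" "threshold k n \<alpha> lam j r \<le> lam"
    "G_tilde k n (threshold k n \<alpha> lam j r / lam)
       \<le> real r * (\<alpha> * (1 - lam) / (lam * (real n - real j + 1)))"
proof -
  have s: "0 < real r * \<alpha> * (1 - lam) / (lam * (real n - real j + 1))"
    using assms by (intro divide_pos_pos mult_pos_pos) auto
  note b = capped_G_tilde_inv_bounds[OF assms(1,2) s]
  show "0 < threshold k n \<alpha> lam j r" "threshold k n \<alpha> lam j r \<le> lam"
    using b assms by (simp_all add: threshold_def)
  show "G_tilde k n (threshold k n \<alpha> lam j r / lam)
       \<le> real r * (\<alpha> * (1 - lam) / (lam * (real n - real j + 1)))"
    using b(3) assms by (simp add: threshold_def mult.assoc)
qed

lemma threshold_mono: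
  assumes "1 \<le> k" "k \<le> n" "0 < \<alpha>" "0 < lam" "lam < 1" "r \<le> r'" "j \<le> n"
  shows "threshold k n \<alpha> lam j r \<le> threshold k n \<alpha> lam j r'"
  unfolding threshold_def using assms
  by (intro mult_left_mono capped_G_tilde_inv_mono divide_right_mono mult_right_mono) auto

text \<open>
  Because the thresholds increase, the \<open>r\<close> smallest p-values are exactly those that are at most \<open>c r\<close>,
  so the way in which ties are broken does not matter.
\<close>

lemma procedure2_cases:
  fixes q :: "nat \<Rightarrow> real"
  assumes "1 \<le> k" "k \<le> n" "0 < \<alpha>" "0 < lam" "lam < 1"
  defines "j \<equiv> count_le {1..n} q lam"
  defines "c \<equiv> threshold k n \<alpha> lam j"
  obtains (empty) "procedure2 k n \<alpha> lam q = {}"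
  | (reject) r where "r \<in> {1..j}" "count_le {1..n} q (c r) = r"
      "\<And>r'. r' \<in> {Suc r..j} \<Longrightarrow> count_le {1..n} q (c r') < r'"
      "procedure2 k n \<alpha> lam q = {i \<in> {1..n}. q i \<le> c r}"
proof -
  have jn: "j \<le> n"
    using count_le_le_card[of "{1..n}" q lam] by (simp add: j_def)
  \<comment> \<open>The condition passes to smaller indices, so the set is an initial segment and
    its maximum is a count.\<close>
  have stage1: "stage1_set n lam q = {1..j}"
    using jn by (auto simp: stage1_set_def ordered_pval_le_iff j_def)
  define L where "L = stage2_set k n \<alpha> lam q j"
  have L: "L = {i \<in> {1..j}. i \<le> count_le {1..n} q (c i)}"
    using jn by (auto simp: L_def stage2_set_def c_def threshold_def[symmetric] ordered_pval_le_iff)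
  then have fin: "finite L" by simp
  consider "j = 0 \<or> L = {}" | "1 \<le> j" "L \<noteq> {}" by fastforce
  then show ?thesis
  proof cases
    case 1
    show ?thesis
    proof (rule empty)
      show "procedure2 k n \<alpha> lam q = {}"
      proof (cases "j = 0")
        case False
        then have "Max {1..j} = j" by (intro Max_eqI) auto
        then show ?thesis using False 1 by (simp add: procedure2_def stage1 L_def Let_def)
      qed (simp add: procedure2_def stage1)
    qed
  next
    case 2
    define r where "r = Max L"
    have "r \<in> L" using fin 2 by (simp add: r_def)
    then have r: "r \<in> {1..j}" "r \<le> count_le {1..n} q (c r)" by (auto simp: L)
    have above: "count_le {1..n} q (c r') < r'" if "r' \<in> {Suc r..j}" for r'
    proof (rule ccontr)
      assume "\<not> count_le {1..n} q (c r') < r'"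
      then have "r' \<in> L" using that r by (simp add: L)
      then have "r' \<le> r" unfolding r_def by (rule Max_ge[OF fin])
      then show False using that by simp
    qed
    have "c r \<le> lam"
      unfolding c_def using assms r jn by (intro threshold_bounds) auto
    then have le_j: "count_le {1..n} q (c r) \<le> j"
      unfolding j_def by (intro count_le_mono) auto
    \<comment> \<open>A larger count would let \<open>Suc r\<close> pass the second stage too, since
      the thresholds increase; this contradicts the maximality of \<open>r\<close>.\<close>
    have "count_le {1..n} q (c r) = r"
    proof (rule ccontr)
      assume "count_le {1..n} q (c r) \<noteq> r"
      then have *: "Suc r \<le> count_le {1..n} q (c r)" using r by simp
      also have "\<dots> \<le> count_le {1..n} q (c (Suc r))"
        unfolding c_def using assms jn by (intro count_le_mono threshold_mono) auto
      finally show False using above[of "Suc r"] * le_j by simp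
    qed
    moreover from this have "ordered_hyp n q ` {1..r} = {i \<in> {1..n}. q i \<le> c r}"
      using r jn by (intro ordered_hyp_image) auto
    moreover have "Max {1..j} = j" using 2 by (intro Max_eqI) auto
    ultimately show ?thesis
      using r above 2 by (intro reject[of r]) (auto simp: procedure2_def stage1 Let_def L_def r_def)
  qed
qed

section \<open>From conditional bounds on the counts to the k-FDR\<close>

lemma (in prob_space) prob_le_uniform:
  assumes X: "X \<in> borel_measurable M" and "distr M borel X = uniform_measure lborel {0..1}"
    and "0 \<le> \<theta>" "\<theta> \<le> (1 :: real)"
  shows "prob {\<omega> \<in> space M. X \<omega> \<le> \<theta>} = \<theta>"
proof -
  have "prob {\<omega> \<in> space M. X \<omega> \<le> \<theta>} = measure (distr M borel X) {..\<theta>}"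
    using X by (subst measure_distr) (auto intro!: arg_cong[where f = prob])
  also have "\<dots> = measure lborel ({0..1} \<inter> {..\<theta>}) / measure lborel {0..1::real}"
    unfolding assms(2) by (intro measure_uniform_measure) auto
  also have "{0..1} \<inter> {..\<theta>} = {0..\<theta>}" using assms by auto
  finally show ?thesis using assms by simp
qed

theorem theorem4p2:
  fixes M :: "'a measure" and p :: "nat \<Rightarrow> 'a \<Rightarrow> real" and T :: "nat set"
    and k n :: nat and \<alpha> lam :: real
  assumes "prob_space M"
    and "1 \<le> k" and "k \<le> n"
    and "0 < \<alpha>" and "\<alpha> < 1"
    and "0 < lam" and "lam < 1"
    and "T \<subseteq> {1..n}"
    and "\<And>i \<omega>. i \<in> {1..n} \<Longrightarrow> \<omega> \<in> space M \<Longrightarrow> p i \<omega> \<in> {0..1}"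
    and "prob_space.indep_vars M (\<lambda>_. borel) p {1..n}"
    and "\<And>i. i \<in> T \<Longrightarrow> distr M borel (p i) = uniform_measure lborel {0..1}"
  shows "kFDR M k T (\<lambda>\<omega>. procedure2 k n \<alpha> lam (\<lambda>i. p i \<omega>)) \<le> \<alpha>"
proof -
  interpret prob_space M by fact
  note k = \<open>1 \<le> k\<close> \<open>k \<le> n\<close> and \<alpha> = \<open>0 < \<alpha>\<close> and lam = \<open>0 < lam\<close> \<open>lam < 1\<close> and T = \<open>T \<subseteq> {1..n}\<close>
  note params = k \<alpha> lam
  interpret null_pvalues M p "{1..n}" T
  proof
    fix i \<theta> assume i: "i \<in> T" and \<theta>: "0 \<le> \<theta>" "\<theta> \<le> (1 :: real)"
    have "p i \<in> borel_measurable M"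
      using assms(10) i T by (auto simp: indep_vars_def)
    from prob_le_uniform[OF this assms(11)[OF i] \<theta>]
    show "prob {\<omega> \<in> space M. p i \<omega> \<le> \<theta>} = \<theta>" .
  qed (use T assms(10) in auto)
  let ?m = "card T"
  let ?c = "threshold k n \<alpha> lam"
  let ?C = "count_le {1..n}"
  define \<beta> where "\<beta> j = \<alpha> * (1 - lam) / (lam * (real n - real j + 1))" for j :: nat
  \<comment> \<open>\<open>F\<close> fixes both counts at \<open>lam\<close>. On it,
    \<open>A\<close> means at least \<open>r\<close> rejections, and \<open>B\<close> means exactly
    \<open>r\<close>, of which \<open>z\<close> are false.\<close>
  define F where "F x j q \<longleftrightarrow> N lam q = x \<and> ?C q lam = j" for x j q
  define A where "A x j r q \<longleftrightarrow> F x j q \<and> (\<exists>s\<in>{r..j}. s \<le> ?C q (?c j s))" for x j r q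
  define B where "B x j r z q \<longleftrightarrow> (A x j r q \<and> \<not> A x j (Suc r) q) \<and> N (?c j r) q = z" for x j r z q
  have [measurable]: "(\<lambda>q. ?C q \<theta>) \<in> measurable (PiM {1..n} (\<lambda>_. borel)) (count_space UNIV)" for \<theta>
    by (rule obs_count_le) simp
  have obs_F [measurable]: "obs (F x j)" for x j
    unfolding F_def by measurable
  have obs_A [measurable]: "obs (A x j r)" for x j r
    unfolding A_def by measurable
  have obs_B: "obs (B x j r z)" for x j r z
    unfolding B_def by measurable
  have C_le: "?C q \<theta> \<le> n" for q \<theta>
    using count_le_le_card[of "{1..n}" q \<theta>] by simp

  have bound: "(\<Sum>r=1..j. \<Sum>z=k..?m. real z / real r * pr (B x j r z)) \<le> \<beta> j * real x * pr (F x j)"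
    if j: "j \<le> n" and x: "x \<in> {k..?m}" for x j
    unfolding B_def
  proof (rule weighted_moment_bound[where L = lam])
    have xn: "x \<le> n" using x card_mono[OF _ T] by simp
    show "0 < ?c j r \<and> ?c j r \<le> lam" if "r \<in> {1..j}" for r
      using threshold_bounds[OF params, of r j] that j by auto
    show "?c j r \<le> ?c j (Suc r)" for r
      using threshold_mono[OF params, of r "Suc r" j] j by auto
    show F_stable: "F x j (q(i := v))" if "i \<in> T" "q i \<le> lam" "v \<le> lam" "F x j q" for q i v
      using that by (simp add: F_def count_le_upd_same)
    show "A x j r (q(i := v))"
      if r: "r \<in> {1..j}" and i: "i \<in> T" "q i \<le> lam" "v \<le> ?c j r" "A x j r q" for r q i v
    proof -
      from \<open>A x j r q\<close> obtain s where s: "s \<in> {r..j}" "s \<le> ?C q (?c j s)" and F: "F x j q"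
        by (auto simp: A_def)
      \<comment> \<open>The witness \<open>s\<close> survives: setting a p-value to at most
        \<open>?c j r \<le> ?c j s\<close> cannot lower the count at \<open>?c j s\<close>.\<close>
      have "v \<le> ?c j s"
        using i(3) threshold_mono[OF params, of r s j] s j by auto
      then have "s \<le> ?C (q(i := v)) (?c j s)"
        using count_le_upd_mono[of "{1..n}" v "?c j s" q i] s by simp
      moreover have "v \<le> lam"
        using i(3) threshold_bounds(2)[OF params, of r j] r j by auto
      then have "F x j (q(i := v))" by (intro F_stable i F)
      ultimately show ?thesis using s by (auto simp: A_def)
    qed
    show "A x j r q" if "A x j (Suc r) q" for r q
      using that by (auto simp: A_def intro: bexI[rotated])
    show "obs (A x j r)" "obs (F x j)" for r by (rule obs_A obs_F)+
    show "0 \<le> \<beta> j" using \<alpha> lam j by (simp add: \<beta>_def)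
    show "?c j r / lam * binom_tail (k - 1) (x - 1) (?c j r / lam) \<le> real r * \<beta> j"
      if r: "r \<in> {1..j}" for r
    proof -
      note b = threshold_bounds[OF params, of r j]
      have u: "0 \<le> ?c j r / lam" "?c j r / lam \<le> 1" using b(1,2) r j lam by auto
      \<comment> \<open>The conditional moment involves \<open>x\<close> trials, the procedure
        \<open>n\<close>. Fewer trials make the tail smaller, so the threshold bound for
        \<open>G_tilde k n\<close> applies.\<close>
      have "?c j r / lam * binom_tail (k - 1) (x - 1) (?c j r / lam)
          \<le> ?c j r / lam * binom_tail (k - 1) (n - 1) (?c j r / lam)"
        using u xn by (intro mult_left_mono binom_tail_mono) auto
      also have "\<dots> \<le> real r * \<beta> j"
        using b(3) r j by (simp add: G_tilde_def \<beta>_def)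
      finally show ?thesis .
    qed
  qed (use k lam x in \<open>auto simp: F_def A_def\<close>)

  define V where "V \<omega> = real (card (procedure2 k n \<alpha> lam (\<lambda>i. p i \<omega>) \<inter> T))
    * (if card (procedure2 k n \<alpha> lam (\<lambda>i. p i \<omega>) \<inter> T) \<ge> k then 1 else 0)
    / real (max (card (procedure2 k n \<alpha> lam (\<lambda>i. p i \<omega>))) 1)" for \<omega>
  \<comment> \<open>The loss is spread over the finitely many cells \<open>(x, j, r, z)\<close>. The
    sum \<open>W\<close> is integrable because it is a combination of indicators, and it dominates
    \<open>V\<close>.\<close>
  define S where "S = (SIGMA x:{k..?m}. SIGMA j:{..n}. {1..j} \<times> {k..?m})"
  have fin_S: "finite S" by (simp add: S_def)
  define W where "W \<omega> = (\<Sum>(x, j, r, z)\<in>S. real z / real r *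
    indicator {\<omega> \<in> space M. B x j r z (pvec \<omega>)} \<omega>)" for \<omega>
  have VW: "V \<omega> \<le> W \<omega>" if \<omega>: "\<omega> \<in> space M" for \<omega>
  proof -
    let ?q = "\<lambda>i. p i \<omega>"
    let ?R = "procedure2 k n \<alpha> lam ?q"
    have W0: "0 \<le> W \<omega>"
      unfolding W_def by (intro sum_nonneg) auto
    have C_pvec: "?C (pvec \<omega>) \<theta> = ?C ?q \<theta>" and N_pvec: "N \<theta> (pvec \<omega>) = N \<theta> ?q" for \<theta>
      by (rule count_le_cong, rule pvec_apply, use T in blast)+
    show ?thesis
      using params
    proof (cases rule: procedure2_cases[of k n \<alpha> lam ?q])
      case empty
      then show ?thesis using W0 by (simp add: V_def)
    next
      case (reject r)
      define j where "j = ?C ?q lam"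
      define z where "z = N (?c j r) ?q"
      define x where "x = N lam ?q"
      note reject = reject[folded j_def]
      have cardR: "card ?R = r"
        using reject(2,4) by (simp add: count_le_def)
      have "?R \<inter> T = {i \<in> T. p i \<omega> \<le> ?c j r}"
        using reject(4) T by auto
      then have cardV: "card (?R \<inter> T) = z"
        by (simp add: z_def count_le_def)
      show ?thesis
      proof (cases "k \<le> z")
        case False
        then show ?thesis using W0 by (simp add: V_def cardV)
      next
        case True
        have jn: "j \<le> n" unfolding j_def by (rule C_le)
        have "z \<le> x"
          unfolding z_def x_def using threshold_bounds(2)[OF params, of r j] reject(1) jn
          by (intro N_mono) auto
        moreover have "x \<le> ?m" unfolding x_def by (rule N_le_card)
        ultimately have mem: "(x, j, r, z) \<in> S"
          using True reject(1) jn by (auto simp: S_def)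
        have "F x j (pvec \<omega>)" unfolding F_def C_pvec N_pvec x_def j_def by simp
        moreover have "\<exists>s\<in>{r..j}. s \<le> ?C (pvec \<omega>) (?c j s)"
          unfolding C_pvec using reject(1,2) by (intro bexI[of _ r]) auto
        moreover have "\<not> (\<exists>s\<in>{Suc r..j}. s \<le> ?C (pvec \<omega>) (?c j s))"
          unfolding C_pvec using reject(3) by (auto simp: not_le)
        ultimately have "B x j r z (pvec \<omega>)"
          unfolding B_def A_def N_pvec z_def by blast
        \<comment> \<open>A single term of \<open>W\<close> already equals \<open>V\<close>, and all
          others are nonnegative.\<close>
        then have "V \<omega> = (\<lambda>(x, j, r, z). real z / real r *
            indicator {\<omega> \<in> space M. B x j r z (pvec \<omega>)} \<omega>) (x, j, r, z)"
          using \<omega> True reject(1) by (simp add: V_def cardV cardR max_def)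
        also have "\<dots> \<le> W \<omega>"
          unfolding W_def using fin_S mem by (intro member_le_sum) auto
        finally show ?thesis .
      qed
    qed
  qed
  have B_sets: "{\<omega> \<in> space M. B x j r z (pvec \<omega>)} \<in> sets M" for x j r z
    by (rule obs_sets[OF obs_B])
  have W_int: "integrable M W"
    unfolding W_def case_prod_beta using B_sets
    by (intro Bochner_Integration.integrable_sum integrable_mult_right)
      (auto simp: integrable_indicator_iff emeasure_eq_measure)
  have "expectation W = (\<Sum>(x, j, r, z)\<in>S. real z / real r * pr (B x j r z))"
    unfolding W_def case_prod_beta pr_def using B_sets
    by (subst Bochner_Integration.integral_sum)
      (auto simp: integrable_indicator_iff emeasure_eq_measure)
  also have "\<dots> = (\<Sum>x=k..?m. \<Sum>j\<le>n. \<Sum>r=1..j. \<Sum>z=k..?m. real z / real r * pr (B x j r z))"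
    unfolding S_def by (simp add: sum.Sigma)
  also have "\<dots> \<le> (\<Sum>x=k..?m. \<Sum>j\<le>n. \<beta> j * real x * pr (F x j))"
    by (intro sum_mono bound) auto
  also have "\<dots> \<le> (\<Sum>x=k..?m. \<Sum>j\<le>n. \<alpha> * ((1 - lam) / lam * (real x / real (?m - x + 1))) * pr (F x j))"
  proof (intro sum_mono)
    fix x j assume x: "x \<in> {k..?m}" and j: "j \<in> {..n}"
    show "\<beta> j * real x * pr (F x j) \<le> \<alpha> * ((1 - lam) / lam * (real x / real (?m - x + 1))) * pr (F x j)"
    \<comment> \<open>The \<open>?m - x\<close> true null p-values above \<open>lam\<close> are
      among the \<open>n - j\<close> p-values above \<open>lam\<close>, so a cell violating the
      inequality has probability 0.\<close>
    proof (cases "?m - x \<le> n - j")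
      case True
      have "\<beta> j \<le> \<alpha> * (1 - lam) / (lam * real (?m - x + 1))"
        unfolding \<beta>_def using True x j \<alpha> lam
        by (intro divide_left_mono mult_left_mono mult_pos_pos) auto
      then have "\<beta> j * real x * pr (F x j) \<le> \<alpha> * (1 - lam) / (lam * real (?m - x + 1)) * real x * pr (F x j)"
        by (intro mult_right_mono pr_nonneg) auto
      then show ?thesis by simp
    next
      case False
      have "\<not> F x j q" for q
      proof
        assume F: "F x j q"
        have "{i \<in> T. lam < q i} \<subseteq> {i \<in> {1..n}. lam < q i}" using T by auto
        then have "card {i \<in> T. lam < q i} \<le> card {i \<in> {1..n}. lam < q i}"
          by (intro card_mono) auto
        then show False
          using F False card_gt[OF finite_T, of lam q] card_gt[of "{1..n}" lam q] by (simp add: F_def)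
      qed
      then have "pr (F x j) = 0" by (rule pr_False)
      then show ?thesis by simp
    qed
  qed
  \<comment> \<open>The coefficient no longer involves \<open>j\<close>, so summing over
    \<open>j\<close> leaves the law of \<open>N lam\<close>.\<close>
  also have "\<dots> = \<alpha> * (\<Sum>x=k..?m. (1 - lam) / lam * (real x / real (?m - x + 1)) * pr (\<lambda>q. N lam q = x))"
    unfolding sum_distrib_left
  proof (intro sum.cong refl)
    fix x
    have "pr (\<lambda>q. N lam q = x) = (\<Sum>j\<le>n. pr (F x j))"
      unfolding F_def
    proof (rule pr_split)
      show "obs (\<lambda>q. N lam q = x)" by (rule obs_N)
      show "obs (\<lambda>q. N lam q = x \<and> ?C q lam = j)" for j
        using obs_F[of x j] unfolding F_def .
    qed (use C_le in auto)
    then show "(\<Sum>j\<le>n. \<alpha> * ((1 - lam) / lam * (real x / real (?m - x + 1))) * pr (F x j))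
        = \<alpha> * ((1 - lam) / lam * (real x / real (?m - x + 1)) * pr (\<lambda>q. N lam q = x))"
      by (simp add: sum_distrib_left mult.assoc)
  qed
  also have "\<dots> \<le> \<alpha> * 1"
    using shifted_count_sum[OF lam k(1)] \<alpha> by (intro mult_left_mono) auto
  finally have W: "expectation W \<le> \<alpha>" by simp
  have "expectation V \<le> \<alpha>"
    \<comment> \<open>The Bochner integral of a non-integrable function is 0, so \<open>V\<close> need not be shown measurable.\<close>
  proof (cases "integrable M V")
    case True
    then have "expectation V \<le> expectation W"
      using W_int VW by (intro integral_mono) auto
    with W show ?thesis by simp
  next
    case False
    then show ?thesis using \<alpha> by (simp add: not_integrable_integral_eq)
  qed
  then show ?thesis unfolding kFDR_def V_def .
qed

end
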